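(* Let $Y=X\beta+\epsilon$ with $\beta\in\mathbb{R}^p$ $s$-sparse, $\epsilon$ having i.i.d. $N(0,\sigma^2)$ entries, and the columns of $X$ having $\ell_2$ norm $\sqrt n$. Let $s_0$ be the essential sparsity of $\beta$. Suppose $\Lambda_{\max}(2s)<\infty$, $\Lambda_{\min}(2s)>0$, and $\mathrm{RE}(s_0,4,X)$ holds. Let $a\ge0$, $d_0\ge2\sqrt{1+a}$, and let $\beta_{\mathrm{init}}$ be an optimal solution of the Lasso $$\min_{b\in\mathbb{R}^p}\ \frac1{2n}\|Y-Xb\|_2^2+\lambda_n\|b\|_1,\qquad\lambda_n=d_0\lambda\sigma\ \ (\ge2\lambda_{\sigma,a,p}).$$ Let $T_0$ be the set of positions of the $s_0$ largest coordinates of $\beta$ in absolute value, $T_1$ the set of the $s_0$ largest positions (in absolute value) of $\beta_{\mathrm{init}}$ outside of $T_0$, and $T_{01}=T_0\cup T_1$. Let $A_0=\{j:|\beta_j|>\lambda\sigma\}$ and $a_0=|A_0|$. Suppose that for some constants $\breve D_1>D_1$, $\breve D_0>D_0$, $$\beta_{\min,A_0}:=\min_{j\in A_0}|\beta_j|\ge D_0\lambda\sigma\sqrt{s_0}+(\breve D_1\wedge\breve D_0)\lambda\sigma.$$ Set $t_0=(\breve D_1\wedge\breve D_0)\lambda\sigma$, $I=\{j:|\beta_{j,\mathrm{init}}|\ge t_0\}$ and $\mathcal{D}=[p]\setminus I$. Let $\hat\beta_I=(X_I^TX_I)^{-1}X_I^TY$ and let $\hat\beta^{\mathrm{ols}}(I)\in\mathbb{R}^p$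 equal $\hat\beta_I$ on $I$ and $0$ on $I^c$. Then on the event $\mathcal{T}_a$, $|I|\le2s_0$, $$A_0\subset I,\qquad I\cap T_{01}^c=\emptyset,\qquad\|\beta_{\mathcal{D}}\|_2\le\lambda\sigma\sqrt{s_0-a_0},$$ and $$\|\hat\beta^{\mathrm{ols}}(I)-\beta\|_2^2\le\Big(1+\frac{(\Lambda_{\max}(2s)-\Lambda_{\min}(2s))^2+8(1+a)}{2\Lambda_{\min}^2(|I|)}\Big)s_0\lambda^2\sigma^2.$$
   Context: Setting: $n,p$ are positive integers with $p\ge n$, $p\ge2$; $[p]=\{1,\dots,p\}$; $X\in\mathbb{R}^{n\times p}$ is a fixed design matrix with columns $X_j$; $\sigma>0$; $S=\mathrm{supp}(\beta)$ and $s=|S|$; $\lambda=\sqrt{2\log p/n}$. For $T\subseteq[p]$, $X_T$ is the submatrix of columns indexed by $T$, and $v_T$ is the restriction of a vector $v$ to $T$. A vector is $m$-sparse if it has at most $m$ nonzero entries. $x\vee y=\max(x,y)$, $x\wedge y=\min(x,y)$. Essential sparsity: $s_0$ is the smallest integer such that $\sum_{i=1}^p\min(\beta_i^2,\lambda^2\sigma^2)\le s_0\lambda^2\sigma^2$. Sparse eigenvalues: $\Lambda_{\max}(m)=\max\|Xv\|_2^2/(n\|v\|_2^2)$ and $\Lambda_{\min}(m)=\min\|Xv\|_2^2/(n\|v\|_2^2)$, both over nonzero $m$-sparse $v\in\mathbb{R}^p$; $\Lambda_{\max}(0)=0$. Restricted orthogonality: $\theta_{m,m'}$ is the smallest number such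 that $|\langle X_Tv,X_{T'}v'\rangle|/n\le\theta_{m,m'}\|v\|_2\|v'\|_2$ for all disjoint $T,T'\subseteq[p]$ with $|T|\le m$, $|T'|\le m'$ and all $v\in\mathbb{R}^{|T|},v'\in\mathbb{R}^{|T'|}$. Restricted eigenvalue: for $m\in[p]$, $k_0>0$, $\mathrm{RE}(m,k_0,X)$ holds with $K(m,k_0)$ if $$\frac1{K(m,k_0)}:=\min_{J\subseteq[p],|J|\le m}\ \min_{v\ne0,\ \|v_{J^c}\|_1\le k_0\|v_J\|_1}\frac{\|Xv\|_2}{\sqrt n\,\|v_J\|_2}>0.$$ Noise event: for $a\ge0$, $\lambda_{\sigma,a,p}=\sigma\sqrt{1+a}\sqrt{2\log p/n}$ and $\mathcal{T}_a=\{\epsilon:\|X^T\epsilon/n\|_\infty\le\lambda_{\sigma,a,p}\}$. Constants: $$\ell(s_0)=\frac{\theta_{s_0,2s_0}}{\sqrt{\Lambda_{\min}(2s_0)}}\wedge\sqrt{\Lambda_{\max}(s_0)},\qquad D=\sqrt{\frac{\Lambda_{\max}(s-s_0)}{\Lambda_{\min}(2s_0)}}\Big(1+\frac{3\ell(s_0)\sqrt{\Lambda_{\max}(s-s_0)}}{d_0}\Big),$$ $$D_0=D\vee\sqrt2\big(d_0K^2(s_0,4)+K(s_0,3)\sqrt{\Lambda_{\max}(s-s_0)}+2d_0K^2(s_0,3)\big),$$ $$D_1=d_0\Big[\Big(\frac{\Lambda_{\max}(s-s_0)}{d_0^2}+\frac94K^2(s_0,3)\Big)\vee4K^2(s_0,4)\vee\frac{3\Lambda_{\max}(s-s_0)}{d_0^2}\Big].$$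 *)

theory Defs
  imports "HOL-Probability.Probability"
begin

text \<open>The design is \<open>X :: real ^ 'p ^ 'n\<close>: \<open>n = CARD('n)\<close> rows, \<open>p = CARD('p)\<close> columns, and
  \<open>'p\<close> plays the role of \<open>[p]\<close>.  A vector \<open>v\<^sub>T\<close> indexed by \<open>T\<close> is represented by its zero
  extension, so that \<open>X\<^sub>T v\<^sub>T = X *v vrestr T v\<close>.\<close>

definition vrestr :: "'p set \<Rightarrow> real ^ 'p \<Rightarrow> real ^ 'p" where
  "vrestr T v = (\<chi> j. if j \<in> T then v $ j else 0)"

definition supp :: "real ^ 'p \<Rightarrow> 'p set" where
  "supp v = {j. v $ j \<noteq> 0}"

definition l1norm :: "real ^ 'p \<Rightarrow> real" where
  "l1norm v = (\<Sum>j\<in>UNIV. \<bar>v $ j\<bar>)"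

definition sparse_quotients :: "real ^ 'p ^ 'n \<Rightarrow> nat \<Rightarrow> real set" where
  "sparse_quotients X m =
     {(norm (X *v v))\<^sup>2 / (real CARD('n) * (norm v)\<^sup>2) | v. v \<noteq> 0 \<and> card (supp v) \<le> m}"

definition Lambda_max :: "real ^ 'p ^ 'n \<Rightarrow> nat \<Rightarrow> real" where
  "Lambda_max X m = (if m = 0 then 0 else Sup (sparse_quotients X m))"

text \<open>The minimum over the empty set at \<open>m = 0\<close> is \<open>\<infinity>\<close> by the usual convention.  It is only ever
  used through \<open>c / (Lambda_min X 0)\<^sup>2\<close>, which is then \<open>0\<close>; since \<open>c / 0 = 0\<close>, the value \<open>0\<close>
  for \<open>Lambda_min X 0\<close> encodes exactly this.\<close>

definition Lambda_min :: "real ^ 'p ^ 'n \<Rightarrow> nat \<Rightarrow> real" where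
  "Lambda_min X m = (if m = 0 then 0 else Inf (sparse_quotients X m))"

definition theta :: "real ^ 'p ^ 'n \<Rightarrow> nat \<Rightarrow> nat \<Rightarrow> real" where
  "theta X m m' = Inf {c. \<forall>T T' v v'. T \<inter> T' = {} \<and> card T \<le> m \<and> card T' \<le> m' \<longrightarrow>
     \<bar>(X *v vrestr T v) \<bullet> (X *v vrestr T' v')\<bar> / real CARD('n)
       \<le> c * norm (vrestr T v) * norm (vrestr T' v')}"

text \<open>The denominator below is nonzero: \<open>v\<^sub>J = 0\<close> together with the cone condition gives \<open>v = 0\<close>.\<close>

definition RE_quotients :: "real ^ 'p ^ 'n \<Rightarrow> nat \<Rightarrow> real \<Rightarrow> real set" where
  "RE_quotients X m k0 =
     {norm (X *v v) / (sqrt (real CARD('n)) * norm (vrestr J v)) | J v.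
        card J \<le> m \<and> v \<noteq> 0 \<and> l1norm (vrestr (- J) v) \<le> k0 * l1norm (vrestr J v)}"

definition RE_const :: "real ^ 'p ^ 'n \<Rightarrow> nat \<Rightarrow> real \<Rightarrow> real" where
  "RE_const X m k0 = 1 / Inf (RE_quotients X m k0)"

definition RE :: "real ^ 'p ^ 'n \<Rightarrow> nat \<Rightarrow> real \<Rightarrow> bool" where
  "RE X m k0 \<longleftrightarrow> 1 \<le> m \<and> m \<le> CARD('p) \<and> 0 < k0 \<and> 0 < Inf (RE_quotients X m k0)"

definition base_level :: "nat \<Rightarrow> nat \<Rightarrow> real" where
  "base_level n p = sqrt (2 * ln (real p) / real n)"

definition essential_sparsity :: "real \<Rightarrow> real \<Rightarrow> real ^ 'p \<Rightarrow> nat" where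
  "essential_sparsity lam \<sigma> \<beta> =
     (LEAST k. (\<Sum>i\<in>UNIV. min ((\<beta> $ i)\<^sup>2) (lam\<^sup>2 * \<sigma>\<^sup>2)) \<le> real k * lam\<^sup>2 * \<sigma>\<^sup>2)"

definition noise_event :: "real ^ 'p ^ 'n \<Rightarrow> real \<Rightarrow> real \<Rightarrow> (real ^ 'n) set" where
  "noise_event X \<sigma> a =
     {e. infnorm ((1 / real CARD('n)) *\<^sub>R (transpose X *v e))
           \<le> \<sigma> * sqrt (1 + a) * sqrt (2 * ln (real CARD('p)) / real CARD('n))}"

definition lasso_objective :: "real ^ 'p ^ 'n \<Rightarrow> real ^ 'n \<Rightarrow> real \<Rightarrow> real ^ 'p \<Rightarrow> real" where
  "lasso_objective X Y lam_n b =
     1 / (2 * real CARD('n)) * (norm (Y - X *v b))\<^sup>2 + lam_n * l1norm b"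

text \<open>\<open>T\<close> consists of \<open>k\<close> positions in \<open>U\<close> at which \<open>\<bar>v\<bar>\<close> is largest, with ties broken
  arbitrarily; if \<open>U\<close> has fewer than \<open>k\<close> elements, then \<open>T = U\<close>.\<close>

definition largest_positions :: "nat \<Rightarrow> real ^ 'p \<Rightarrow> 'p set \<Rightarrow> 'p set \<Rightarrow> bool" where
  "largest_positions k v U T \<longleftrightarrow> T \<subseteq> U \<and> card T = min k (card U) \<and>
     (\<forall>i\<in>T. \<forall>j\<in>U - T. \<bar>v $ j\<bar> \<le> \<bar>v $ i\<bar>)"

definition col_restr :: "real ^ 'p ^ 'n \<Rightarrow> 'p set \<Rightarrow> real ^ 'p ^ 'n" where
  "col_restr X I = (\<chi> i j. if j \<in> I then X $ i $ j else 0)"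

text \<open>With \<open>X\<^sub>I\<close> extended by zero columns, \<open>X\<^sub>I\<^sup>T X\<^sub>I\<close> vanishes outside the \<open>I \<times> I\<close> block.  Adding
  the identity on the complementary block makes it a block diagonal matrix, the \<open>I \<times> I\<close> block of
  whose inverse is the inverse of the Gram matrix of the columns in \<open>I\<close>.\<close>

definition ols :: "real ^ 'p ^ 'n \<Rightarrow> real ^ 'n \<Rightarrow> 'p set \<Rightarrow> real ^ 'p" where
  "ols X Y I = vrestr I
     (matrix_inv (transpose (col_restr X I) ** col_restr X I
                  + (\<chi> i j. if i = j \<and> i \<notin> I then 1 else 0))
      *v (transpose (col_restr X I) *v Y))"

definition ell :: "real ^ 'p ^ 'n \<Rightarrow> nat \<Rightarrow> real" where
  "ell X s0 = min (theta X s0 (2 * s0) / sqrt (Lambda_min X (2 * s0))) (sqrt (Lambda_max X s0))"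

definition const_D :: "real ^ 'p ^ 'n \<Rightarrow> real \<Rightarrow> nat \<Rightarrow> nat \<Rightarrow> real" where
  "const_D X d0 s s0 =
     sqrt (Lambda_max X (s - s0) / Lambda_min X (2 * s0))
     * (1 + 3 * ell X s0 * sqrt (Lambda_max X (s - s0)) / d0)"

definition const_D0 :: "real ^ 'p ^ 'n \<Rightarrow> real \<Rightarrow> nat \<Rightarrow> nat \<Rightarrow> real" where
  "const_D0 X d0 s s0 =
     max (const_D X d0 s s0)
       (sqrt 2 * (d0 * (RE_const X s0 4)\<^sup>2 + RE_const X s0 3 * sqrt (Lambda_max X (s - s0))
                  + 2 * d0 * (RE_const X s0 3)\<^sup>2))"

definition const_D1 :: "real ^ 'p ^ 'n \<Rightarrow> real \<Rightarrow> nat \<Rightarrow> nat \<Rightarrow> real" where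
  "const_D1 X d0 s s0 =
     d0 * max (max (Lambda_max X (s - s0) / d0\<^sup>2 + 9 / 4 * (RE_const X s0 3)\<^sup>2)
                   (4 * (RE_const X s0 4)\<^sup>2))
              (3 * Lambda_max X (s - s0) / d0\<^sup>2)"

end

theory Submission
  imports Defs
begin

text \<open>
  Put \<open>L = lam * \<sigma>\<close> and let \<open>h = \<beta>init - vrestr T0 \<beta>\<close>, the error of the Lasso against the leading part of
  \<open>\<beta>\<close>.  The argument is pathwise: it fixes an outcome in the noise event, where the correlation of the
  noise with each column is at most half the penalty level.

  The essential sparsity is a budget: \<open>A0\<close> has at most \<open>s0\<close> elements, hence lies in \<open>T0\<close>, and the
  part of \<open>\<beta>\<close> off any set containing \<open>A0\<close> has squared norm at most \<open>(s0 - a0) * L\<^sup>2\<close>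
  (\<open>norm_tail_le\<close>).  First-order optimality of the Lasso solution gives a quadratic inequality between the
  prediction error of \<open>h\<close>, the \<open>\<ell>\<^sub>1\<close> norms of \<open>h\<close> on and off \<open>T0\<close>, and the contribution of the
  neglected small coefficients (\<open>lasso_basic_inequality\<close>).  According to the cone in which \<open>h\<close> lies,
  either restricted eigenvalues or sparse eigenvalues turn it into
  the bounds \<open>const_D1 * L * s0\<close> for the \<open>\<ell>\<^sub>1\<close> norm of \<open>h\<close> off \<open>T0\<close> and
  \<open>const_D0 * L * sqrt s0\<close> for the \<open>\<ell>\<^sub>2\<close> norm of \<open>h\<close> on \<open>T0 \<union> T1\<close> (\<open>lasso_error_bounds\<close>).

  The second bound shows that coefficients in \<open>A0\<close> stay above the threshold.  An estimated
  coefficient outside \<open>T0 \<union> T1\<close> is no larger than each of the \<open>s0\<close> entries on \<open>T1\<close>, so by averaging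
  each of the two bounds puts it strictly below the threshold (\<open>thresholding_selects\<close>).  Therefore
  \<open>A0 \<subseteq> I \<subseteq> T0 \<union> T1\<close>, and \<open>I\<close> together with the support of \<open>\<beta>\<close> has at most \<open>2 * s\<close> elements.  For
  such \<open>I\<close> the normal equations bound the error of least squares on \<open>I\<close> by the noise level and
  by the correlation between selected and omitted columns; polarization bounds that correlation by half
  the spread of the sparse eigenvalues of order \<open>2 * s\<close> (\<open>ols_error_on_model\<close>, \<open>ols_total_error\<close>).\<close>

section \<open>Restrictions of vectors and their norms\<close>

lemma vrestr_nth [simp]: "vrestr T v $ j = (if j \<in> T then v $ j else 0)"
  by (simp add: vrestr_def)

lemma vrestr_Un_disjoint:
  "T \<inter> U = {} \<Longrightarrow> vrestr (T \<union> U) v = vrestr T v + vrestr U v"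
  by (auto simp: vec_eq_iff)

lemma vrestr_add_Compl: "vrestr T v + vrestr (- T) v = v"
  by (auto simp: vec_eq_iff)

lemma supp_vrestr: "supp (vrestr T v) \<subseteq> T"
  by (auto simp: supp_def)

lemma norm_sq_sum: "(norm (v :: real ^ 'p))\<^sup>2 = (\<Sum>j\<in>UNIV. (v $ j)\<^sup>2)"
  by (simp add: power2_norm_eq_inner inner_vec_def) (simp add: power2_eq_square)

lemma norm_vrestr_sq: "(norm (vrestr T v))\<^sup>2 = (\<Sum>j\<in>T. (v $ j)\<^sup>2)"
proof -
  have "(norm (vrestr T v))\<^sup>2 = (\<Sum>j\<in>UNIV. if j \<in> T then (v $ j)\<^sup>2 else 0)"
    unfolding norm_sq_sum by (rule sum.cong) auto
  then show ?thesis by (simp add: sum.If_cases)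
qed

lemma l1norm_vrestr: "l1norm (vrestr T v) = (\<Sum>j\<in>T. \<bar>v $ j\<bar>)"
proof -
  have "l1norm (vrestr T v) = (\<Sum>j\<in>UNIV. if j \<in> T then \<bar>v $ j\<bar> else 0)"
    unfolding l1norm_def by (rule sum.cong) auto
  then show ?thesis by (simp add: sum.If_cases)
qed

lemma l1norm_vrestr_nonneg: "0 \<le> l1norm (vrestr T v)"
  by (simp add: l1norm_vrestr sum_nonneg)

lemma l1norm_vrestr_Compl: "l1norm v = l1norm (vrestr T v) + l1norm (vrestr (- T) v)"
  using sum.union_disjoint[of T "- T" "\<lambda>j. \<bar>v $ j\<bar>"]
  by (simp add: l1norm_vrestr Compl_partition) (simp add: l1norm_def)

lemma l1norm_vrestr_le_norm: "l1norm (vrestr T v) \<le> sqrt (card T) * norm (vrestr T v)"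
proof -
  have "(\<Sum>j\<in>T. 1 * \<bar>v $ j\<bar>)\<^sup>2 \<le> (\<Sum>j\<in>T. 1\<^sup>2) * (\<Sum>j\<in>T. \<bar>v $ j\<bar>\<^sup>2)"
    by (rule Cauchy_Schwarz_ineq_sum)
  then have "(l1norm (vrestr T v))\<^sup>2 \<le> card T * (norm (vrestr T v))\<^sup>2"
    by (simp add: l1norm_vrestr norm_vrestr_sq)
  also have "\<dots> = (sqrt (card T) * norm (vrestr T v))\<^sup>2"
    by (simp add: power_mult_distrib)
  finally show ?thesis by (rule power2_le_imp_le) simp
qed

lemma norm_vrestr_le_bound:
  assumes "\<And>j. j \<in> T \<Longrightarrow> \<bar>v $ j\<bar> \<le> M" "card T \<le> m" "0 \<le> M"
  shows "norm (vrestr T v) \<le> sqrt (real m) * M"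
proof (rule power2_le_imp_le)
  have "(norm (vrestr T v))\<^sup>2 \<le> (\<Sum>j\<in>T. M\<^sup>2)"
    unfolding norm_vrestr_sq
    by (intro sum_mono) (use assms in \<open>metis abs_ge_zero power2_abs power_mono\<close>)
  also have "\<dots> \<le> m * M\<^sup>2" using assms by (simp add: mult_right_mono)
  finally show "(norm (vrestr T v))\<^sup>2 \<le> (sqrt (real m) * M)\<^sup>2" by (simp add: power_mult_distrib)
qed (use assms in simp)

text \<open>Duality of the sup norm and the \<open>\<ell>\<^sub>1\<close> norm, in the form in which the noise event is used.\<close>

lemma inner_mat_le_l1norm:
  fixes X :: "real ^ 'p ^ 'n"
  assumes "infnorm (c *\<^sub>R (transpose X *v e)) \<le> M"
  shows "\<bar>c * ((X *v u) \<bullet> e)\<bar> \<le> M * l1norm u"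
proof -
  let ?g = "c *\<^sub>R (transpose X *v e)"
  have "c * ((X *v u) \<bullet> e) = (\<Sum>j\<in>UNIV. u $ j * ?g $ j)"
    by (simp add: dot_lmul_matrix[symmetric] vector_transpose_matrix inner_commute
        flip: inner_real_def) (simp add: inner_vec_def sum_distrib_left mult_ac)
  also have "\<bar>\<dots>\<bar> \<le> (\<Sum>j\<in>UNIV. \<bar>u $ j\<bar> * M)"
    by (rule order.trans[OF sum_abs], rule sum_mono, unfold abs_mult,
        rule mult_left_mono, rule order.trans[OF component_le_infnorm_cart assms]) simp
  finally show ?thesis by (simp add: l1norm_def sum_distrib_left mult_ac)
qed

section \<open>Sparse eigenvalues, restricted orthogonality and restricted eigenvalues\<close>

lemma bdd_above_sparse_quotients: "bdd_above (sparse_quotients X m)"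
proof -
  obtain B where B: "\<And>v. norm (X *v v) \<le> norm v * B" "0 \<le> B"
    using bounded_linear.nonneg_bounded[OF matrix_vector_mul_bounded_linear[of X]] by blast
  show ?thesis
  proof (rule bdd_aboveI[of _ "B\<^sup>2 / real CARD('b)"])
    fix q assume "q \<in> sparse_quotients X m"
    then obtain v where v: "v \<noteq> 0" "q = (norm (X *v v))\<^sup>2 / (real CARD('b) * (norm v)\<^sup>2)"
      by (auto simp: sparse_quotients_def)
    have "(norm (X *v v))\<^sup>2 \<le> (norm v * B)\<^sup>2" using B by (intro power_mono) auto
    then have "(norm (X *v v))\<^sup>2 / (norm v)\<^sup>2 \<le> B\<^sup>2"
      using v(1) by (simp add: pos_divide_le_eq power_mult_distrib mult_ac)
    then show "q \<le> B\<^sup>2 / real CARD('b)"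
      using v(2) divide_right_mono[of _ _ "real CARD('b)"] by (fastforce simp: mult.commute)
  qed
qed

lemma bdd_below_sparse_quotients: "bdd_below (sparse_quotients X m)"
  by (rule bdd_belowI[of _ 0]) (auto simp: sparse_quotients_def)

lemma norm_mult_le_Lambda_max:
  fixes X :: "real ^ 'p ^ 'n"
  assumes "card (supp v) \<le> m"
  shows "(norm (X *v v))\<^sup>2 \<le> real CARD('n) * Lambda_max X m * (norm v)\<^sup>2"
proof (cases "v = 0")
  case False
  then have "supp v \<noteq> {}" by (auto simp: supp_def vec_eq_iff)
  then have "m \<noteq> 0" using assms by (auto simp: card_eq_0_iff)
  moreover have "(norm (X *v v))\<^sup>2 / (real CARD('n) * (norm v)\<^sup>2) \<in> sparse_quotients X m"
    using assms False by (auto simp: sparse_quotients_def)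
  ultimately have "(norm (X *v v))\<^sup>2 / (real CARD('n) * (norm v)\<^sup>2) \<le> Lambda_max X m"
    by (simp add: Lambda_max_def cSup_upper bdd_above_sparse_quotients)
  then show ?thesis using False by (simp add: pos_divide_le_eq mult_ac)
qed simp

lemma Lambda_min_le_norm_mult:
  fixes X :: "real ^ 'p ^ 'n"
  assumes "card (supp v) \<le> m"
  shows "real CARD('n) * Lambda_min X m * (norm v)\<^sup>2 \<le> (norm (X *v v))\<^sup>2"
proof (cases "v = 0")
  case False
  then have "supp v \<noteq> {}" by (auto simp: supp_def vec_eq_iff)
  then have "m \<noteq> 0" using assms by (auto simp: card_eq_0_iff)
  moreover have "(norm (X *v v))\<^sup>2 / (real CARD('n) * (norm v)\<^sup>2) \<in> sparse_quotients X m"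
    using assms False by (auto simp: sparse_quotients_def)
  ultimately have "Lambda_min X m \<le> (norm (X *v v))\<^sup>2 / (real CARD('n) * (norm v)\<^sup>2)"
    by (simp add: Lambda_min_def cInf_lower bdd_below_sparse_quotients)
  then show ?thesis using False by (simp add: pos_le_divide_eq mult_ac)
qed simp

lemma supp_axis: "supp (axis j (1::real)) = {j}"
  by (auto simp: supp_def axis_def)

lemma sparse_quotients_nonempty: "1 \<le> m \<Longrightarrow> sparse_quotients X m \<noteq> {}"
proof -
  assume "1 \<le> m"
  then have "axis j (1::real) \<noteq> 0 \<and> card (supp (axis j (1::real))) \<le> m" for j :: 'a
    by (simp add: supp_axis axis_eq_0_iff)
  then show ?thesis unfolding sparse_quotients_def by blast
qed

lemma Lambda_max_nonneg: "0 \<le> Lambda_max X m"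
proof (cases "m = 0")
  case False
  then obtain q where "q \<in> sparse_quotients X m" using sparse_quotients_nonempty[of m X] by auto
  moreover from this have "0 \<le> q" by (auto simp: sparse_quotients_def)
  ultimately show ?thesis
    using False bdd_above_sparse_quotients[of X m] by (auto simp: Lambda_max_def intro: cSup_upper2)
qed (simp add: Lambda_max_def)

lemma Lambda_min_antimono:
  assumes "1 \<le> m" "m \<le> m'"
  shows "Lambda_min X m' \<le> Lambda_min X m"
proof -
  have "sparse_quotients X m \<subseteq> sparse_quotients X m'"
    using assms unfolding sparse_quotients_def by (auto intro: order.trans)
  then show ?thesis
    using assms sparse_quotients_nonempty[of m X] bdd_below_sparse_quotients[of X m']
    by (auto simp: Lambda_min_def intro: cInf_superset_mono)
qed

text \<open>\<open>theta\<close> is an infimum of admissible constants.  It is admissible itself because each single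
  instance of the inequality bounds every admissible constant from below; the square of the operator
  norm of \<open>X\<close> shows that admissible constants exist.\<close>

lemma abs_inner_le_theta:
  fixes X :: "real ^ 'p ^ 'n"
  assumes "T \<inter> T' = {}" "card T \<le> m" "card T' \<le> m'"
  shows "\<bar>(X *v vrestr T v) \<bullet> (X *v vrestr T' v')\<bar> / real CARD('n)
       \<le> theta X m m' * norm (vrestr T v) * norm (vrestr T' v')"
proof -
  let ?S = "{c. \<forall>T T' v v'. T \<inter> T' = {} \<and> card T \<le> m \<and> card T' \<le> m' \<longrightarrow>
     \<bar>(X *v vrestr T v) \<bullet> (X *v vrestr T' v')\<bar> / real CARD('n)
       \<le> c * norm (vrestr T v) * norm (vrestr T' v')}"
  let ?P = "norm (vrestr T v) * norm (vrestr T' v')"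
  obtain B where B: "\<And>v. norm (X *v v) \<le> norm v * B" "0 \<le> B"
    using bounded_linear.nonneg_bounded[OF matrix_vector_mul_bounded_linear[of X]] by blast
  have "B\<^sup>2 / real CARD('n) \<in> ?S"
  proof (clarify)
    fix T T' :: "'p set" and v v'
    have "\<bar>(X *v vrestr T v) \<bullet> (X *v vrestr T' v')\<bar> \<le> norm (X *v vrestr T v) * norm (X *v vrestr T' v')"
      by (rule Cauchy_Schwarz_ineq2)
    also have "\<dots> \<le> (norm (vrestr T v) * B) * (norm (vrestr T' v') * B)"
      using B by (intro mult_mono) auto
    finally show "\<bar>(X *v vrestr T v) \<bullet> (X *v vrestr T' v')\<bar> / real CARD('n)
       \<le> B\<^sup>2 / real CARD('n) * norm (vrestr T v) * norm (vrestr T' v')"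
      by (simp add: divide_simps power2_eq_square mult_ac)
  qed
  then have ne: "?S \<noteq> {}" by blast
  show ?thesis
  proof (cases "?P = 0")
    case True
    then show ?thesis by (auto simp: mult_eq_0_iff)
  next
    case False
    then have pos: "0 < ?P" using norm_ge_zero by (metis less_eq_real_def mult_nonneg_nonneg)
    have "\<bar>(X *v vrestr T v) \<bullet> (X *v vrestr T' v')\<bar> / real CARD('n) / ?P \<le> theta X m m'"
      unfolding theta_def
    proof (rule cInf_greatest[OF ne])
      fix c assume "c \<in> ?S"
      then have "\<bar>(X *v vrestr T v) \<bullet> (X *v vrestr T' v')\<bar> / real CARD('n)
         \<le> c * norm (vrestr T v) * norm (vrestr T' v')"
        using assms by blast
      then show "\<bar>(X *v vrestr T v) \<bullet> (X *v vrestr T' v')\<bar> / real CARD('n) / ?P \<le> c"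
        using pos by (simp only: pos_divide_le_eq mult.assoc)
    qed
    then show ?thesis using pos by (simp only: pos_divide_le_eq mult.assoc)
  qed
qed

text \<open>Two distinct columns force every admissible constant to be nonnegative; without them the
  infimum would range over all reals.\<close>

lemma theta_nonneg:
  fixes X :: "real ^ 'p ^ 'n"
  assumes "1 \<le> m" "1 \<le> m'" "2 \<le> CARD('p)"
  shows "0 \<le> theta X m m'"
proof -
  obtain i j :: 'p where ij: "i \<noteq> j"
    using card_2_iff'[of "UNIV :: 'p set"] assms(3) card_le_Suc0_iff_eq[of "UNIV :: 'p set"] by force
  have "0 \<le> \<bar>(X *v vrestr {i} 1) \<bullet> (X *v vrestr {j} 1)\<bar> / real CARD('n)" by simp
  also have "\<dots> \<le> theta X m m' * norm (vrestr {i} (1 :: real^'p)) * norm (vrestr {j} (1 :: real^'p))"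
    using assms ij by (intro abs_inner_le_theta) auto
  finally have "0 \<le> theta X m m' * norm (vrestr {i} (1 :: real^'p)) * norm (vrestr {j} (1 :: real^'p))" .
  moreover have "norm (vrestr {l} (1 :: real^'p)) = 1" for l
    using norm_vrestr_sq[of "{l}" 1] norm_ge_zero[of "vrestr {l} (1 :: real^'p)"]
    by (auto simp: power2_eq_1_iff)
  ultimately show ?thesis by simp
qed

lemma RE_quotients_bdd_below: "bdd_below (RE_quotients X m k0)"
  by (rule bdd_belowI[of _ 0]) (auto simp: RE_quotients_def)

lemma RE_cone_bound:
  fixes X :: "real ^ 'p ^ 'n"
  assumes "RE X m k0" "card J \<le> m" "l1norm (vrestr (- J) v) \<le> k0 * l1norm (vrestr J v)"
  shows "norm (vrestr J v) \<le> RE_const X m k0 * (norm (X *v v) / sqrt (real CARD('n)))"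
proof (cases "vrestr J v = 0")
  case True
  then show ?thesis using assms by (simp add: RE_const_def RE_def)
next
  case False
  then have "v \<noteq> 0" by (auto simp: vec_eq_iff split: if_splits)
  then have "norm (X *v v) / (sqrt (real CARD('n)) * norm (vrestr J v)) \<in> RE_quotients X m k0"
    using assms unfolding RE_quotients_def by blast
  then have "Inf (RE_quotients X m k0) \<le> norm (X *v v) / (sqrt (real CARD('n)) * norm (vrestr J v))"
    by (rule cInf_lower[OF _ RE_quotients_bdd_below])
  moreover have "0 < Inf (RE_quotients X m k0)" using assms by (simp add: RE_def)
  ultimately show ?thesis
    using False by (simp add: RE_const_def field_simps)
qed

lemma RE_antimono:
  assumes "RE X m k0" "0 < k" "k \<le> k0"
  shows "RE X m k"
proof -
  have sub: "RE_quotients X m k \<subseteq> RE_quotients X m k0"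
    unfolding RE_quotients_def
    using assms by (blast intro: order.trans mult_right_mono l1norm_vrestr_nonneg)
  obtain j :: 'a where True by blast
  let ?e = "axis j (1::real)"
  have "?e \<noteq> 0" "card {j} \<le> m" "l1norm (vrestr (- {j}) ?e) \<le> k * l1norm (vrestr {j} ?e)"
    using assms by (auto simp: RE_def axis_eq_0_iff l1norm_vrestr) (simp add: axis_def)
  then have "RE_quotients X m k \<noteq> {}" unfolding RE_quotients_def by blast
  then have "Inf (RE_quotients X m k0) \<le> Inf (RE_quotients X m k)"
    by (rule cInf_superset_mono[OF _ RE_quotients_bdd_below sub])
  then show ?thesis using assms by (auto simp: RE_def)
qed

section \<open>Largest positions and shelling\<close>

lemma largest_positions_exists: "\<exists>T. largest_positions k v U T"
proof (induction k)
  case 0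
  have "largest_positions 0 v U {}" by (simp add: largest_positions_def)
  then show ?case ..
next
  case (Suc k)
  then obtain T where T: "T \<subseteq> U" "card T = min k (card U)"
    "\<And>i j. i \<in> T \<Longrightarrow> j \<in> U - T \<Longrightarrow> \<bar>v $ j\<bar> \<le> \<bar>v $ i\<bar>"
    by (auto simp: largest_positions_def)
  show ?case
  proof (cases "U - T = {}")
    case True
    then have "T = U" using T(1) by blast
    then have "largest_positions (Suc k) v U T" using T by (auto simp: largest_positions_def)
    then show ?thesis ..
  next
    case False
    let ?M = "Max ((\<lambda>j. \<bar>v $ j\<bar>) ` (U - T))"
    have "?M \<in> (\<lambda>j. \<bar>v $ j\<bar>) ` (U - T)" using False by (intro Max_in) auto
    then obtain i where i: "i \<in> U - T" "\<bar>v $ i\<bar> = ?M" by auto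
    have max: "\<bar>v $ j\<bar> \<le> \<bar>v $ i\<bar>" if "j \<in> U - T" for j
      using that i(2) by (simp add: Max_ge)
    have "card T < card U" using T(1) False by (intro psubset_card_mono) auto
    then have "largest_positions (Suc k) v U (insert i T)"
      using T i max by (auto simp: largest_positions_def)
    then show ?thesis ..
  qed
qed

lemma card_largest_positions:
  "largest_positions k v U T \<Longrightarrow> j \<in> U - T \<Longrightarrow> card T = k"
  using card_subset_eq[of U T] by (auto simp: largest_positions_def min_def split: if_splits)

lemma abs_le_mean_largest:
  assumes "largest_positions k v U T" "j \<in> U - T" "1 \<le> k"
  shows "\<bar>v $ j\<bar> \<le> l1norm (vrestr T v) / real k"
proof -
  have "real (card T) * \<bar>v $ j\<bar> \<le> l1norm (vrestr T v)"
    unfolding l1norm_vrestr using assms by (intro sum_bounded_below) (auto simp: largest_positions_def)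
  then show ?thesis
    using card_largest_positions[OF assms(1,2)] assms(3) by (simp add: pos_le_divide_eq mult.commute)
qed

text \<open>Exchange argument: the terms of \<open>T - J\<close> are at most, and those of \<open>J - T\<close> at least, the smallest
  value of \<open>f\<close> on \<open>J - T\<close>.\<close>

lemma sum_le_sum_largest:
  fixes f :: "'p::finite \<Rightarrow> real"
  assumes "\<And>i j. i \<in> J \<Longrightarrow> j \<notin> J \<Longrightarrow> f j \<le> f i" "\<And>i. 0 \<le> f i" "card T \<le> card J"
  shows "sum f T \<le> sum f J"
proof -
  have T: "sum f T = sum f (T \<inter> J) + sum f (T - J)"
    by (metis finite sum.Int_Diff)
  have J: "sum f J = sum f (T \<inter> J) + sum f (J - T)"
    by (metis finite sum.Int_Diff Int_commute)
  have card: "card (T - J) \<le> card (J - T)"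
    using assms(3) card_Int_Diff[of T J] card_Int_Diff[of J T] by (simp add: Int_commute)
  have "sum f (T - J) \<le> sum f (J - T)"
  proof (cases "J - T = {}")
    case True
    then have "card (T - J) = 0" using card by (metis card.empty le_zero_eq)
    then have "T - J = {}" by (meson card_0_eq finite)
    then show ?thesis using True by (metis order_refl)
  next
    case False
    define c where "c = Min (f ` (J - T))"
    have c: "c \<in> f ` (J - T)" unfolding c_def using False by (intro Min_in) auto
    then have "sum f (T - J) \<le> real (card (T - J)) * c"
      using assms(1) by (intro sum_bounded_above) auto
    also have "\<dots> \<le> real (card (J - T)) * c"
      using c assms(2) card by (intro mult_right_mono) auto
    also have "\<dots> \<le> sum f (J - T)"
      unfolding c_def by (intro sum_bounded_below) simp
    finally show ?thesis .
  qed
  then show ?thesis using T J by simp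
qed

text \<open>The restricted eigenvalue condition controls \<open>v\<close> on the set \<open>T0\<close> that defines the cone.  It
  controls \<open>v\<close> equally well on every other set of the same size: replacing \<open>T0\<close> by the \<open>m\<close> largest
  positions \<open>J\<close> of \<open>v\<close> moves \<open>\<ell>\<^sub>1\<close> mass from outside to inside, so the cone condition holds for \<open>J\<close>,
  and \<open>J\<close> carries the largest \<open>\<ell>\<^sub>2\<close> mass among all sets of at most \<open>m\<close> positions.\<close>

lemma RE_cone_bound_any_set:
  fixes X :: "real ^ 'p ^ 'n"
  assumes re: "RE X m k0" and T0: "card T0 \<le> m"
    and cone: "l1norm (vrestr (- T0) v) \<le> k0 * l1norm (vrestr T0 v)"
    and T: "card T \<le> m"
  shows "norm (vrestr T v) \<le> RE_const X m k0 * (norm (X *v v) / sqrt (real CARD('n)))"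
proof -
  obtain J where "largest_positions m v UNIV J" using largest_positions_exists by blast
  then have J: "card J = min m CARD('p)" "\<And>i j. i \<in> J \<Longrightarrow> j \<notin> J \<Longrightarrow> \<bar>v $ j\<bar> \<le> \<bar>v $ i\<bar>"
    by (auto simp: largest_positions_def)
  have le: "card U \<le> card J" if "card U \<le> m" for U :: "'p set"
    using that J(1) card_mono[of UNIV U] by simp
  have k0: "0 < k0" using re by (simp add: RE_def)
  have l1: "l1norm (vrestr T0 v) \<le> l1norm (vrestr J v)"
    unfolding l1norm_vrestr by (rule sum_le_sum_largest) (use J le T0 in auto)
  then have "l1norm (vrestr (- J) v) \<le> l1norm (vrestr (- T0) v)"
    using l1norm_vrestr_Compl[of v J] l1norm_vrestr_Compl[of v T0] by simp
  also have "\<dots> \<le> k0 * l1norm (vrestr J v)"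
    using cone l1 k0 by (meson less_imp_le mult_left_mono order.trans)
  finally have "norm (vrestr J v) \<le> RE_const X m k0 * (norm (X *v v) / sqrt (real CARD('n)))"
    using J(1) by (intro RE_cone_bound[OF re]) auto
  moreover have "norm (vrestr T v) \<le> norm (vrestr J v)"
  proof (rule power2_le_imp_le)
    show "(norm (vrestr T v))\<^sup>2 \<le> (norm (vrestr J v))\<^sup>2"
      unfolding norm_vrestr_sq
      by (rule sum_le_sum_largest) (use J le T in \<open>auto simp flip: abs_le_square_iff\<close>)
  qed simp
  ultimately show ?thesis by simp
qed

text \<open>Cut \<open>U\<close> into consecutive blocks of \<open>k\<close> positions with decreasing \<open>\<bar>v\<bar>\<close>.  Every entry of a block
  is at most the mean of the preceding block, so the \<open>\<ell>\<^sub>2\<close> norm of a block is at most \<open>1 / sqrt k\<close>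
  times the \<open>\<ell>\<^sub>1\<close> norm of the preceding one; the bound \<open>M\<close> plays the part of that mean for the
  first block.  Formulating this for a subadditive \<open>f\<close> serves both \<open>norm (X *v v)\<close> and
  \<open>\<bar>(X *v v) \<bullet> w\<bar>\<close>, that is, both terms of the minimum in \<open>ell\<close>.\<close>

lemma shelling:
  fixes f :: "real ^ 'p \<Rightarrow> real"
  assumes k: "1 \<le> k" and c: "0 \<le> c"
    and zero: "f 0 \<le> 0" and sub: "\<And>u w. f (u + w) \<le> f u + f w"
    and block: "\<And>T. T \<subseteq> U \<Longrightarrow> card T \<le> k \<Longrightarrow> f (vrestr T v) \<le> c * norm (vrestr T v)"
    and M: "0 \<le> M" "\<And>j. j \<in> U \<Longrightarrow> \<bar>v $ j\<bar> \<le> M"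
  shows "f (vrestr U v) \<le> c * sqrt (real k) * (M + l1norm (vrestr U v) / real k)"
  using block M
proof (induction "card U" arbitrary: U M rule: less_induct)
  case less
  show ?case
  proof (cases "U = {}")
    case True
    have "f (vrestr U v) \<le> 0" using zero True by (simp add: vrestr_def zero_vec_def[symmetric])
    also have "0 \<le> c * sqrt (real k) * (M + l1norm (vrestr U v) / real k)"
      using c less.prems(2) l1norm_vrestr_nonneg[of U v] by auto
    finally show ?thesis .
  next
    case False
    obtain T where top: "largest_positions k v U T" using largest_positions_exists by blast
    then have T: "T \<subseteq> U" "card T = min k (card U)" by (auto simp: largest_positions_def)
    have "card U \<noteq> 0" using False by (simp add: card_eq_0_iff)
    then have "T \<noteq> {}" using T(2) k by (metis card.empty min_def not_one_le_zero)
    then have lt: "card (U - T) < card U" using T(1) by (intro psubset_card_mono) auto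
    let ?M = "l1norm (vrestr T v) / real k"
    have M': "\<bar>v $ j\<bar> \<le> ?M" if "j \<in> U - T" for j
      by (rule abs_le_mean_largest[OF top that k])
    have rest: "f (vrestr (U - T) v) \<le> c * sqrt (real k) * (?M + l1norm (vrestr (U - T) v) / real k)"
      by (rule less.hyps[OF lt])
        (use less.prems(1) M' l1norm_vrestr_nonneg[of T v] in \<open>auto simp: subset_eq\<close>)
    have split: "vrestr U v = vrestr T v + vrestr (U - T) v"
      using vrestr_Un_disjoint[of T "U - T" v] T(1) by (simp add: Un_absorb1)
    have l1: "l1norm (vrestr U v) = l1norm (vrestr T v) + l1norm (vrestr (U - T) v)"
      unfolding l1norm_vrestr using T(1) by (simp add: sum.subset_diff)
    have "f (vrestr T v) \<le> c * norm (vrestr T v)"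
      by (rule less.prems(1)) (use T in auto)
    also have "\<dots> \<le> c * (sqrt (real k) * M)"
      by (rule mult_left_mono[OF norm_vrestr_le_bound c]) (use T less.prems in auto)
    finally have "f (vrestr T v) \<le> c * sqrt (real k) * M" by (simp add: mult_ac)
    then have "f (vrestr U v) \<le> c * sqrt (real k) * M
        + c * sqrt (real k) * (?M + l1norm (vrestr (U - T) v) / real k)"
      using sub[of "vrestr T v" "vrestr (U - T) v"] rest split by simp
    then show ?thesis by (simp add: l1 add_divide_distrib distrib_left)
  qed
qed

section \<open>First-order optimality of the Lasso and its consequences\<close>

lemma l1norm_convex_step:
  assumes "0 \<le> t" "t \<le> 1"
  shows "l1norm (b - t *\<^sub>R (b - c)) \<le> (1 - t) * l1norm b + t * l1norm c"
proof -
  have "\<bar>(b - t *\<^sub>R (b - c)) $ j\<bar> \<le> (1 - t) * \<bar>b $ j\<bar> + t * \<bar>c $ j\<bar>" for j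
  proof -
    have "(b - t *\<^sub>R (b - c)) $ j = (1 - t) * b $ j + t * c $ j" by (simp add: algebra_simps)
    also have "\<bar>\<dots>\<bar> \<le> \<bar>(1 - t) * b $ j\<bar> + \<bar>t * c $ j\<bar>" by (rule abs_triangle_ineq)
    finally show ?thesis using assms by (simp add: abs_mult)
  qed
  then have "l1norm (b - t *\<^sub>R (b - c)) \<le> (\<Sum>j\<in>UNIV. (1 - t) * \<bar>b $ j\<bar> + t * \<bar>c $ j\<bar>)"
    unfolding l1norm_def by (rule sum_mono)
  then show ?thesis by (simp add: l1norm_def sum.distrib sum_distrib_left)
qed

text \<open>The objective is compared with its values on the segment from the minimiser \<open>b\<close> to \<open>c\<close>.  There
  the quadratic part changes linearly up to a term of order \<open>t\<^sup>2\<close> and the \<open>\<ell>\<^sub>1\<close> part lies below its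
  chord; dividing by \<open>t\<close> and letting \<open>t\<close> tend to \<open>0\<close> gives the claim.\<close>

lemma lasso_first_order:
  fixes X :: "real ^ 'p ^ 'n"
  assumes min: "is_arg_min (lasso_objective X Y L) (\<lambda>_. True) b" and L: "0 \<le> L"
  shows "0 \<le> (Y - X *v b) \<bullet> (X *v (b - c)) / real CARD('n) + L * (l1norm c - l1norm b)"
    (is "0 \<le> ?G")
proof (rule field_le_epsilon)
  fix d :: real assume d: "0 < d"
  let ?n = "real CARD('n)" and ?R = "Y - X *v b" and ?u = "X *v (b - c)"
  define q where "q = (norm ?u)\<^sup>2 / (2 * ?n)"
  \<comment> \<open>With this step size the remainder \<open>t * q\<close> of the expansion stays below \<open>d\<close>.\<close>
  define t where "t = min 1 (d / (q + 1))"
  have q: "0 \<le> q" by (simp add: q_def)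
  then have t: "0 < t" "t \<le> 1" using d by (auto simp: t_def)
  have "t * q \<le> d / (q + 1) * q" using q by (intro mult_right_mono) (auto simp: t_def)
  also have "\<dots> \<le> d" using q d by (simp add: divide_simps mult_left_mono)
  finally have tq: "t * q \<le> d" .
  have res: "Y - X *v (b - t *\<^sub>R (b - c)) = ?R + t *\<^sub>R ?u"
    by (simp add: matrix_vector_mult_diff_distrib matrix_vector_mult_scaleR)
  have sq: "(norm (?R + t *\<^sub>R ?u))\<^sup>2 = (norm ?R)\<^sup>2 + 2 * t * (?R \<bullet> ?u) + t\<^sup>2 * (norm ?u)\<^sup>2"
    using dot_norm[of ?R "t *\<^sub>R ?u"] by (simp add: power_mult_distrib)
  have "lasso_objective X Y L b \<le> lasso_objective X Y L (b - t *\<^sub>R (b - c))"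
    using min by (simp add: is_arg_min_linorder)
  also have "\<dots> \<le> 1 / (2 * ?n) * (norm (?R + t *\<^sub>R ?u))\<^sup>2
      + L * ((1 - t) * l1norm b + t * l1norm c)"
    unfolding lasso_objective_def res using L t by (simp add: mult_left_mono l1norm_convex_step)
  also have "\<dots> = lasso_objective X Y L b + t * (?G + t * q)"
    unfolding sq lasso_objective_def q_def
    by (simp add: field_simps power2_eq_square)
  finally have "0 \<le> t * (?G + t * q)" by simp
  then have "0 \<le> ?G + t * q" using t by (simp add: zero_le_mult_iff)
  then show "0 \<le> ?G + d" using tq by simp
qed

lemma l1norm_diff_le_cone:
  assumes "h = b - vrestr T \<beta>"
  shows "l1norm (vrestr T \<beta>) - l1norm b \<le> l1norm (vrestr T h) - l1norm (vrestr (- T) h)"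
proof -
  have "l1norm b = l1norm (vrestr T b) + l1norm (vrestr (- T) b)" by (rule l1norm_vrestr_Compl)
  moreover have "l1norm (vrestr (- T) b) = l1norm (vrestr (- T) h)"
    unfolding l1norm_vrestr assms by (intro sum.cong) auto
  moreover have "l1norm (vrestr T \<beta>) \<le> l1norm (vrestr T b) + l1norm (vrestr T h)"
    unfolding l1norm_vrestr assms sum.distrib[symmetric] by (intro sum_mono) auto
  ultimately show ?thesis by simp
qed

text \<open>Half of the penalty absorbs the noise term, which leaves \<open>3\<close> as the opening of the cone.  The
  factor \<open>2\<close> in front of the squared prediction error is the gain of the first-order condition over
  comparing the objective at \<open>b\<close> and \<open>vrestr T \<beta>\<close> only, which gives the factor \<open>1\<close>; it makes the
  two squares in the proof of \<open>lasso_regimes\<close> separate, as the form of \<open>const_D1\<close> requires.\<close>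

lemma lasso_basic_inequality:
  fixes X :: "real ^ 'p ^ 'n"
  assumes min: "is_arg_min (lasso_objective X (X *v \<beta> + e) L) (\<lambda>_. True) b"
    and noise: "infnorm ((1 / real CARD('n)) *\<^sub>R (transpose X *v e)) \<le> N" and N: "2 * N \<le> L" "0 \<le> L"
    and h: "h = b - vrestr T \<beta>"
  shows "2 * (norm (X *v h) / sqrt CARD('n))\<^sup>2 + L * l1norm (vrestr (- T) h)
    \<le> 2 * (norm (X *v h) / sqrt CARD('n)) * (norm (X *v vrestr (- T) \<beta>) / sqrt CARD('n))
      + 3 * (L * l1norm (vrestr T h))"
proof -
  let ?n = "real CARD('n)" and ?\<delta> = "vrestr (- T) \<beta>"
  let ?A = "l1norm (vrestr T h)" and ?B = "l1norm (vrestr (- T) h)"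
  have R: "X *v \<beta> + e - X *v b = X *v ?\<delta> + e - X *v h"
    proof -
    have "X *v \<beta> = X *v vrestr T \<beta> + X *v ?\<delta>"
      unfolding matrix_vector_right_distrib[symmetric] vrestr_add_Compl ..
    then show ?thesis by (simp add: h matrix_vector_mult_diff_distrib)
  qed
  have "0 \<le> (X *v ?\<delta> + e - X *v h) \<bullet> (X *v h) / ?n + L * (l1norm (vrestr T \<beta>) - l1norm b)"
    using lasso_first_order[OF min N(2), of "vrestr T \<beta>"] by (simp only: R h)
  also have "\<dots> \<le> (X *v ?\<delta> + e - X *v h) \<bullet> (X *v h) / ?n + L * (?A - ?B)"
    using l1norm_diff_le_cone[OF h] N(2) by (simp add: mult_left_mono)
  also have "(X *v ?\<delta> + e - X *v h) \<bullet> (X *v h) / ?n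
      = (X *v ?\<delta>) \<bullet> (X *v h) / ?n + 1 / ?n * ((X *v h) \<bullet> e) - (norm (X *v h) / sqrt ?n)\<^sup>2"
    unfolding inner_diff_left inner_add_left power_divide power2_norm_eq_inner
    by (simp add: inner_commute[of e] add_divide_distrib diff_divide_distrib)
  also have "(X *v ?\<delta>) \<bullet> (X *v h) / ?n \<le> (norm (X *v h) / sqrt ?n) * (norm (X *v ?\<delta>) / sqrt ?n)"
    using norm_cauchy_schwarz[of "X *v ?\<delta>" "X *v h"] by (simp add: divide_right_mono mult.commute)
  also have "1 / ?n * ((X *v h) \<bullet> e) \<le> L / 2 * (?A + ?B)"
  proof -
    have "1 / ?n * ((X *v h) \<bullet> e) \<le> N * l1norm h"
      using inner_mat_le_l1norm[OF noise, of h] by linarith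
    also have "\<dots> \<le> L / 2 * l1norm h"
      using N l1norm_vrestr_nonneg[of UNIV h] by (intro mult_right_mono) (auto simp: l1norm_def)
    finally show ?thesis by (simp add: l1norm_vrestr_Compl[of h T])
  qed
  finally show ?thesis by (simp add: algebra_simps)
qed

text \<open>Here \<open>x\<close> is the prediction error, \<open>W\<close> bounds the contribution of the small coefficients, and \<open>a\<close>
  and \<open>b\<close> are the scaled \<open>\<ell>\<^sub>1\<close> norms of the estimation error on and off the leading set; \<open>c3\<close> and
  \<open>c4\<close> are scaled restricted eigenvalue constants for the cones of opening \<open>3\<close> and \<open>4\<close>.  If the
  error lies in the cone of opening \<open>3\<close>, completing squares gives
  \<open>b \<le> W\<^sup>2 + 9 / 4 * c3\<^sup>2 - (W - x)\<^sup>2 - (3 / 2 * c3 - x)\<^sup>2\<close>.  Outside that cone the basic inequality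
  forces \<open>x \<le> W\<close>.  Then either the error also leaves the cone of opening \<open>4\<close>, so that \<open>b\<close> is at
  most four times \<open>b - 3 * a \<le> W\<^sup>2 / 2\<close>, or \<open>a \<le> c4 * x\<close> holds and the two alternatives compare
  \<open>W\<close> with \<open>c4\<close>.\<close>

lemma lasso_regimes:
  fixes x W a b c3 c4 :: real
  assumes basic: "2 * x\<^sup>2 + b \<le> 2 * x * W + 3 * a"
    and re3: "b \<le> 3 * a \<Longrightarrow> a \<le> c3 * x" and re4: "b \<le> 4 * a \<Longrightarrow> a \<le> c4 * x"
    and nonneg: "0 \<le> x" "0 \<le> b" "0 \<le> W" "0 \<le> c3"
  shows "b \<le> 3 * a \<and> x \<le> W + 3 / 2 * c3 \<and> b \<le> W\<^sup>2 + 9 / 4 * c3\<^sup>2 \<or>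
    x \<le> W \<and> (b \<le> 3 * W\<^sup>2 \<or> b \<le> 4 * a \<and> W \<le> c4 \<and> b \<le> 4 * c4\<^sup>2)"
proof (cases "b \<le> 3 * a")
  case True
  then have le: "2 * x\<^sup>2 + b \<le> 2 * x * W + 3 * (c3 * x)" using basic re3 by linarith
  have "x \<le> W + 3 / 2 * c3"
  proof (cases "x = 0")
    case False
    have "x * (2 * x) \<le> x * (2 * W + 3 * c3)"
      using le nonneg(2) by (simp add: power2_eq_square algebra_simps)
    then show ?thesis using False nonneg(1) by (simp add: mult_le_cancel_left)
  qed (use nonneg in simp)
  moreover have "0 \<le> (W - x)\<^sup>2 + (3 / 2 * c3 - x)\<^sup>2" by simp
  then have "b \<le> W\<^sup>2 + 9 / 4 * c3\<^sup>2" using le by (simp add: power2_eq_square algebra_simps)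
  ultimately show ?thesis using True by simp
next
  case False
  have "x \<le> W"
  proof (cases "x = 0")
    case x: False
    have "x * x \<le> x * W" using basic False by (simp add: power2_eq_square)
    then show ?thesis using x nonneg(1) by (simp add: mult_le_cancel_left)
  qed (use nonneg in simp)
  moreover have "b \<le> 3 * W\<^sup>2 \<or> b \<le> 4 * a \<and> W \<le> c4 \<and> b \<le> 4 * c4\<^sup>2"
  proof (cases "b \<le> 4 * a")
    case 4: True
    then have a: "a \<le> c4 * x" by (rule re4)
    show ?thesis
    proof (cases "W \<le> c4")
      case True
      have "c4 * x \<le> c4 * c4" using True \<open>x \<le> W\<close> nonneg by (intro mult_left_mono) auto
      then show ?thesis using a 4 True by (simp add: power2_eq_square)
    next
      case c4: False
      have "c4 * x \<le> W * x" using c4 nonneg by (intro mult_right_mono) auto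
      moreover have "0 \<le> (W - x) * (3 * W - 2 * x)" using \<open>x \<le> W\<close> nonneg by simp
      ultimately show ?thesis using basic a by (simp add: power2_eq_square algebra_simps)
    qed
  next
    case 4: False
    have "0 \<le> 2 * (W / 2 - x)\<^sup>2" by simp
    then have "2 * x * W - 2 * x\<^sup>2 \<le> W\<^sup>2 / 2" by (simp add: power2_eq_square algebra_simps)
    then have "b \<le> 2 * W\<^sup>2" using basic 4 by linarith
    then have "b \<le> 3 * W\<^sup>2" using zero_le_power2[of W] by linarith
    then show ?thesis by simp
  qed
  ultimately show ?thesis by simp
qed

section \<open>Sparse eigenvalue bound on the two leading blocks\<close>

text \<open>The vector \<open>h\<close> on \<open>T0 \<union> T1\<close> is \<open>2 * k\<close>-sparse, so the smallest sparse eigenvalue bounds its norm by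
  that of its image under \<open>X\<close>.  That image differs from \<open>X *v h\<close> by the image of the remaining
  entries of \<open>h\<close>, which shelling bounds in two ways: by restricted orthogonality to the image of the
  leading part, or by the triangle inequality.  The smaller of the two gives \<open>ell\<close>.\<close>

lemma norm_two_blocks_le:
  fixes X :: "real ^ 'p ^ 'n"
  assumes k: "1 \<le> k" and p: "2 \<le> CARD('p)" and pos: "0 < Lambda_min X (2 * k)"
    and T0: "card T0 \<le> k" and T1: "largest_positions k h (- T0) T1"
  shows "sqrt (Lambda_min X (2 * k)) * norm (vrestr (T0 \<union> T1) h)
    \<le> norm (X *v h) / sqrt CARD('n) + ell X k * (l1norm (vrestr (- T0) h) / sqrt k)"
proof -
  let ?n = "real CARD('n)" and ?S = "- (T0 \<union> T1)" and ?m = "sqrt (Lambda_min X (2 * k))"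
  let ?B = "l1norm (vrestr (- T0) h)" and ?x = "norm (X *v h) / sqrt CARD('n)"
  define u where "u = vrestr (T0 \<union> T1) h"
  define v where "v = vrestr ?S h"
  define y where "y = norm (X *v u) / sqrt ?n"
  have T1': "T1 \<subseteq> - T0" "card T1 = min k (card (- T0))"
    using T1 by (auto simp: largest_positions_def)
  have card: "card (T0 \<union> T1) \<le> 2 * k" using T0 T1'(2) card_Un_le[of T0 T1] by simp
  have h: "X *v h = X *v u + X *v v"
    using vrestr_add_Compl[of "T0 \<union> T1" h] by (simp add: u_def v_def flip: matrix_vector_right_distrib)
  have M: "\<bar>h $ j\<bar> \<le> l1norm (vrestr T1 h) / k" if "j \<in> ?S" for j
    using that by (intro abs_le_mean_largest[OF T1 _ k]) auto
  have "l1norm (vrestr (- T0) h) = l1norm (vrestr T1 h) + l1norm (vrestr ?S h)"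
  proof -
    have "- T0 = T1 \<union> ?S" "T1 \<inter> ?S = {}" using T1'(1) by auto
    then show ?thesis unfolding l1norm_vrestr by (metis finite sum.union_disjoint)
  qed
  note total = this
  have total: "c * sqrt k * (l1norm (vrestr T1 h) / k + l1norm (vrestr ?S h) / k)
      = c * (?B / sqrt k)" for c
  proof -
    have "sqrt k * (?B / real k) = ?B / sqrt k" using k by (simp add: field_simps)
    then show ?thesis
      unfolding total by (simp only: mult.assoc add_divide_distrib[symmetric])
  qed
  have shell: "f v \<le> c * (?B / sqrt k)"
    if "0 \<le> c" "f 0 \<le> 0" "\<And>u w. f (u + w) \<le> f u + f w"
      "\<And>T. T \<subseteq> ?S \<Longrightarrow> card T \<le> k \<Longrightarrow> f (vrestr T h) \<le> c * norm (vrestr T h)" for f c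
  proof -
    have "0 \<le> l1norm (vrestr T1 h) / k" by (simp add: l1norm_vrestr_nonneg)
    then have "f (vrestr ?S h) \<le> c * sqrt k * (l1norm (vrestr T1 h) / k + l1norm (vrestr ?S h) / k)"
      by (intro shelling[OF k that(1-3)]) (erule that(4) M | assumption)+
    then show ?thesis unfolding v_def total .
  qed
  have my: "?m * norm u \<le> y"
  proof (rule power2_le_imp_le)
    have "card (supp u) \<le> 2 * k"
      using card_mono[OF _ supp_vrestr, of "T0 \<union> T1" h] card by (simp add: u_def)
    then show "(?m * norm u)\<^sup>2 \<le> y\<^sup>2"
      using Lambda_min_le_norm_mult[of u "2 * k" X] pos
      by (simp add: y_def power_mult_distrib power_divide field_simps)
  qed (simp add: y_def)
  have "y \<le> ?x + theta X k (2 * k) / ?m * (?B / sqrt k)"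
  proof (cases "y = 0")
    case True
    then show ?thesis using pos theta_nonneg[of k "2 * k" X] k p l1norm_vrestr_nonneg[of "- T0" h]
      by simp
  next
    case False
    let ?f = "\<lambda>w. \<bar>(X *v w) \<bullet> (X *v u)\<bar> / ?n"
    have th: "0 \<le> theta X k (2 * k)" using k p by (intro theta_nonneg) auto
    have "?f v \<le> theta X k (2 * k) * norm u * (?B / sqrt k)"
    proof (rule shell)
      fix w z show "?f (w + z) \<le> ?f w + ?f z"
        by (simp add: matrix_vector_right_distrib inner_add_left divide_right_mono
            flip: add_divide_distrib)
    next
      fix T assume T: "T \<subseteq> ?S" "card T \<le> k"
      show "?f (vrestr T h) \<le> theta X k (2 * k) * norm u * norm (vrestr T h)"
        using abs_inner_le_theta[of T "T0 \<union> T1" k "2 * k" X h h] T card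
        by (auto simp: u_def mult_ac)
    qed (use th in auto)
    also have "\<dots> \<le> theta X k (2 * k) * (y / ?m) * (?B / sqrt k)"
      using th my pos l1norm_vrestr_nonneg[of "- T0" h]
      by (intro mult_right_mono mult_left_mono) (auto simp: pos_le_divide_eq mult.commute)
    finally have fv: "?f v \<le> y * (theta X k (2 * k) / ?m * (?B / sqrt k))" by (simp add: mult_ac)
    have "y * y = (X *v h) \<bullet> (X *v u) / ?n - (X *v v) \<bullet> (X *v u) / ?n"
      unfolding h by (simp add: y_def inner_add_left add_divide_distrib)
        (simp add: dot_square_norm power2_eq_square)
    also have "\<dots> \<le> ?x * y + ?f v"
    proof -
      have "(X *v h) \<bullet> (X *v u) / ?n \<le> ?x * y"
        using norm_cauchy_schwarz[of "X *v h" "X *v u"] by (simp add: y_def divide_right_mono)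
      moreover have "- ((X *v v) \<bullet> (X *v u) / ?n) \<le> ?f v"
        unfolding minus_divide_left by (rule divide_right_mono) auto
      ultimately show ?thesis by linarith
    qed
    finally have "y * y \<le> y * (?x + theta X k (2 * k) / ?m * (?B / sqrt k))"
      using fv by (simp add: algebra_simps)
    moreover have "0 < y" using False by (simp add: y_def)
    ultimately show ?thesis by (simp add: mult_le_cancel_left)
  qed
  moreover have "y \<le> ?x + sqrt (Lambda_max X k) * (?B / sqrt k)"
  proof -
    let ?f = "\<lambda>w. norm (X *v w) / sqrt ?n"
    have "?f v \<le> sqrt (Lambda_max X k) * (?B / sqrt k)"
    proof (rule shell)
      fix w z show "?f (w + z) \<le> ?f w + ?f z"
        by (simp add: matrix_vector_right_distrib norm_triangle_ineq divide_right_mono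
            flip: add_divide_distrib)
    next
      fix T assume T: "T \<subseteq> ?S" "card T \<le> k"
      have "card (supp (vrestr T h)) \<le> k" using card_mono[OF _ supp_vrestr, of T h] T by simp
      then have "(norm (X *v vrestr T h))\<^sup>2 / ?n \<le> Lambda_max X k * (norm (vrestr T h))\<^sup>2"
        using norm_mult_le_Lambda_max[of "vrestr T h" k X] by (simp add: pos_divide_le_eq mult_ac)
      then have "(?f (vrestr T h))\<^sup>2 \<le> (sqrt (Lambda_max X k) * norm (vrestr T h))\<^sup>2"
        using Lambda_max_nonneg[of X k] by (simp add: power_mult_distrib power_divide)
      then show "?f (vrestr T h) \<le> sqrt (Lambda_max X k) * norm (vrestr T h)"
        by (rule power2_le_imp_le) (simp add: Lambda_max_nonneg)
    qed (use Lambda_max_nonneg[of X k] in auto)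
    moreover have "norm (X *v u) \<le> norm (X *v h) + norm (X *v v)"
      using norm_triangle_ineq4[of "X *v h" "X *v v"] by (simp add: h)
    then have "y \<le> ?x + ?f v" by (simp add: y_def divide_right_mono flip: add_divide_distrib)
    ultimately show ?thesis by simp
  qed
  ultimately have "y \<le> ?x + ell X k * (?B / sqrt k)"
    unfolding ell_def by (simp add: min_def)
  then show ?thesis using my unfolding u_def by linarith
qed

section \<open>Least squares on a selected model\<close>

lemma Lambda_min_le_Lambda_max: "Lambda_min X m \<le> Lambda_max X m"
  using sparse_quotients_nonempty[of m X]
  by (auto simp: Lambda_min_def Lambda_max_def
      intro!: cInf_le_cSup bdd_above_sparse_quotients bdd_below_sparse_quotients)

text \<open>For orthogonal \<open>u\<close> and \<open>v\<close> of equal length, \<open>u + v\<close> and \<open>u - v\<close> are sparse vectors with the same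
  length, so the polarization identity bounds the inner product of the images by the spread of the
  sparse eigenvalues.\<close>

lemma abs_inner_le_polarization:
  fixes X :: "real ^ 'p ^ 'n"
  assumes disj: "supp u \<inter> supp v = {}" and card: "card (supp u \<union> supp v) \<le> m"
  shows "\<bar>(X *v u) \<bullet> (X *v v)\<bar> / real CARD('n)
    \<le> (Lambda_max X m - Lambda_min X m) / 2 * norm u * norm v"
proof (cases "norm u * norm v = 0")
  case True
  then show ?thesis by auto
next
  case False
  then have pos: "0 < norm u * norm v" by (simp add: zero_less_mult_iff)
  let ?n = "real CARD('n)"
  have bound: "(X *v u) \<bullet> (X *v w) / ?n \<le> (Lambda_max X m - Lambda_min X m) / 2 * (norm u * norm w)"
    if w: "supp w = supp v" "norm w = norm v" for w
  proof -
    \<comment> \<open>Rescaling to equal lengths without dividing.\<close>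
    define u' w' where "u' = norm w *\<^sub>R u" and "w' = norm u *\<^sub>R w"
    have "u \<bullet> w = 0"
      using disj w(1) unfolding inner_vec_def supp_def by (intro sum.neutral) auto
    then have orth: "u' \<bullet> w' = 0" by (simp add: u'_def w'_def)
    have len: "u' \<bullet> u' + w' \<bullet> w' = 2 * (norm u * norm w)\<^sup>2"
      unfolding power2_norm_eq_inner[symmetric] by (simp add: u'_def w'_def power_mult_distrib)
    have supp: "supp (u' + w') \<subseteq> supp u \<union> supp v" "supp (u' - w') \<subseteq> supp u \<union> supp v"
    proof -
      have "v $ j = 0 \<Longrightarrow> w $ j = 0" for j using w(1) unfolding supp_def by blast
      then show "supp (u' + w') \<subseteq> supp u \<union> supp v" "supp (u' - w') \<subseteq> supp u \<union> supp v"
        by (auto simp: supp_def u'_def w'_def)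
    qed
    then have "card (supp (u' + w')) \<le> m" "card (supp (u' - w')) \<le> m"
      using card card_mono[OF finite supp(1)] card_mono[OF finite supp(2)] by linarith+
    then have "(norm (X *v (u' + w')))\<^sup>2 - (norm (X *v (u' - w')))\<^sup>2
        \<le> ?n * Lambda_max X m * (norm (u' + w'))\<^sup>2 - ?n * Lambda_min X m * (norm (u' - w'))\<^sup>2"
      by (intro diff_mono norm_mult_le_Lambda_max Lambda_min_le_norm_mult)
    also have "(norm (X *v (u' + w')))\<^sup>2 - (norm (X *v (u' - w')))\<^sup>2 = 4 * ((X *v u') \<bullet> (X *v w'))"
      by (simp add: power2_norm_eq_inner matrix_vector_right_distrib matrix_vector_mult_diff_distrib
          inner_add_left inner_add_right inner_diff_left inner_diff_right inner_commute)
    also have "(norm (u' + w'))\<^sup>2 = 2 * (norm u * norm w)\<^sup>2"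
      using orth len by (simp add: power2_norm_eq_inner inner_add_left inner_add_right inner_commute)
    also have "(norm (u' - w'))\<^sup>2 = 2 * (norm u * norm w)\<^sup>2"
      using orth len by (simp add: power2_norm_eq_inner inner_diff_left inner_diff_right inner_commute)
    also have "(X *v u') \<bullet> (X *v w') = (norm u * norm w) * ((X *v u) \<bullet> (X *v w))"
      by (simp add: u'_def w'_def matrix_vector_mult_scaleR)
    finally have "(norm u * norm w) * (4 * ((X *v u) \<bullet> (X *v w)))
        \<le> (norm u * norm w) * (2 * ?n * (Lambda_max X m - Lambda_min X m) * (norm u * norm w))"
      by (simp add: power2_eq_square algebra_simps)
    then have "4 * ((X *v u) \<bullet> (X *v w)) \<le> 2 * ?n * (Lambda_max X m - Lambda_min X m) * (norm u * norm w)"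
      using pos w(2) by (simp only: mult_le_cancel_left_pos)
    then show ?thesis by (simp add: field_simps)
  qed
  have "supp (- v) = supp v" by (simp add: supp_def)
  then have "(X *v u) \<bullet> (X *v (- v)) / ?n \<le> (Lambda_max X m - Lambda_min X m) / 2 * (norm u * norm v)"
    using bound[of "- v"] by simp
  moreover have "X *v (- v) = - (X *v v)"
    using matrix_vector_mult_scaleR[of X "- 1" v] by simp
  ultimately show ?thesis using bound[of v] by (simp add: abs_if mult.assoc)
qed

lemma col_restr_mult: "col_restr X I *v v = X *v vrestr I v"
  unfolding col_restr_def matrix_vector_mult_def
  by (auto simp: vec_eq_iff intro!: sum.cong)

lemma inner_transpose_mult:
  fixes A :: "real ^ 'p ^ 'n"
  shows "u \<bullet> (transpose A *v w) = (A *v u) \<bullet> w"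
  by (metis dot_lmul_matrix inner_commute vector_transpose_matrix)

lemma vrestr_idem: "vrestr I (vrestr I v) = vrestr I v"
  by (simp add: vec_eq_iff)

text \<open>The matrix inverted in \<open>ols\<close> has the quadratic form
  \<open>(norm (X *v vrestr I v))\<^sup>2 + (norm (vrestr (- I) v))\<^sup>2\<close>, which is definite since the columns in \<open>I\<close> are
  linearly independent.  Hence it is invertible, and testing the linear system against vectors
  supported on \<open>I\<close> removes the auxiliary identity block.\<close>

lemma ols_normal_equations:
  fixes X :: "real ^ 'p ^ 'n"
  assumes pos: "0 < Lambda_min X (card I)"
  shows "(X *v vrestr I u) \<bullet> (X *v ols X Y I) = (X *v vrestr I u) \<bullet> Y"
proof -
  let ?C = "col_restr X I"
  let ?E = "(\<chi> i j. if i = j \<and> i \<notin> I then 1 else 0) :: real ^ 'p ^ 'p"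
  let ?G = "transpose ?C ** ?C + ?E"
  have E: "?E *v v = vrestr (- I) v" for v
  proof -
    have "(\<Sum>j\<in>UNIV. (if i = j \<and> i \<notin> I then 1 else 0) * v $ j) = (if i \<in> I then 0 else v $ i)" for i
      by (simp add: if_distrib[of "\<lambda>t. t * _"] sum.delta cong: if_cong)
    then show ?thesis by (simp add: vec_eq_iff matrix_vector_mult_def)
  qed
  have G: "w \<bullet> (?G *v v) = (X *v vrestr I w) \<bullet> (X *v vrestr I v) + w \<bullet> vrestr (- I) v" for w v
    by (simp add: matrix_vector_mult_add_rdistrib E inner_add_right inner_transpose_mult
        col_restr_mult matrix_vector_mul_assoc[symmetric] del: transpose_matrix_vector)
  have "v = 0" if "?G *v v = 0" for v
  proof -
    have "v \<bullet> vrestr (- I) v = (norm (vrestr (- I) v))\<^sup>2"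
      unfolding power2_norm_eq_inner inner_vec_def by (intro sum.cong) auto
    then have "(norm (X *v vrestr I v))\<^sup>2 + (norm (vrestr (- I) v))\<^sup>2 = 0"
      using G[of v v] that by (simp add: power2_norm_eq_inner)
    then have *: "(norm (X *v vrestr I v))\<^sup>2 = 0" "vrestr (- I) v = 0"
      by (auto simp: sum_power2_eq_zero_iff)
    have "card (supp (vrestr I v)) \<le> card I" by (simp add: card_mono supp_vrestr)
    then have "real CARD('n) * Lambda_min X (card I) * (norm (vrestr I v))\<^sup>2 \<le> 0"
      using Lambda_min_le_norm_mult[of "vrestr I v" "card I" X] * by simp
    then have "vrestr I v = 0" using pos by (simp add: mult_le_0_iff)
    then show "v = 0" using *(2) vrestr_add_Compl[of I v] by simp
  qed
  then have "invertible ?G"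
    by (simp add: invertible_left_inverse matrix_left_invertible_ker)
  then have inv: "?G ** matrix_inv ?G = mat 1"
    unfolding invertible_def matrix_inv_def by (rule someI2_ex) simp
  define z where "z = matrix_inv ?G *v (transpose ?C *v Y)"
  have ols: "ols X Y I = vrestr I z" by (simp add: ols_def z_def)
  have "?G *v z = transpose ?C *v Y"
    unfolding z_def by (subst matrix_vector_mul_assoc) (simp only: inv matrix_vector_mul_lid)
  then have "vrestr I u \<bullet> (?G *v z) = (X *v vrestr I u) \<bullet> Y"
    by (simp only: inner_transpose_mult col_restr_mult vrestr_idem)
  moreover have "vrestr I u \<bullet> vrestr (- I) z = 0"
    unfolding inner_vec_def by (intro sum.neutral) auto
  ultimately show ?thesis using G[of "vrestr I u" z] by (simp add: ols vrestr_idem)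
qed

text \<open>The normal equations say that the image of the error on \<open>I\<close> is tested against two disturbances: the
  omitted coefficients, which act through the almost orthogonality of disjoint sets of columns, and
  the noise, whose correlations with the columns are bounded in sup norm and therefore act against the
  \<open>\<ell>\<^sub>1\<close> norm of an error with at most \<open>card I\<close> nonzero entries.\<close>

lemma ols_error_on_model:
  fixes X :: "real ^ 'p ^ 'n"
  assumes pos: "0 < Lambda_min X (card I)"
    and card: "card (I \<union> supp \<beta>) \<le> m"
    and noise: "infnorm ((1 / real CARD('n)) *\<^sub>R (transpose X *v e)) \<le> N"
  shows "Lambda_min X (card I) * norm (vrestr I (ols X (X *v \<beta> + e) I - \<beta>))
    \<le> (Lambda_max X m - Lambda_min X m) / 2 * norm (vrestr (- I) \<beta>) + N * sqrt (card I)"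
proof -
  let ?n = "real CARD('n)" and ?b = "vrestr (- I) \<beta>"
  define y where "y = X *v \<beta> + e"
  let ?o = "ols X y I"
  define d where "d = vrestr I (?o - \<beta>)"
  have N: "0 \<le> N" using noise infnorm_pos_le order.trans by blast
  have o: "?o = vrestr I \<beta> + d"
    by (auto simp: d_def vec_eq_iff ols_def)
  have y: "y = X *v vrestr I \<beta> + X *v ?b + e"
    unfolding matrix_vector_right_distrib[symmetric] vrestr_add_Compl y_def ..
  have orth: "(X *v d) \<bullet> (X *v ?o) = (X *v d) \<bullet> y"
    unfolding d_def by (rule ols_normal_equations[OF pos])
  have eq: "(norm (X *v d))\<^sup>2 = (X *v d) \<bullet> (X *v ?b) + (X *v d) \<bullet> e"
    using orth unfolding o by (simp add: y matrix_vector_right_distrib inner_add_right power2_norm_eq_inner)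
  have sub: "supp d \<subseteq> I" "supp ?b \<subseteq> supp \<beta> - I"
    unfolding d_def by (rule supp_vrestr) (auto simp: supp_def)
  then have "supp d \<union> supp ?b \<subseteq> I \<union> supp \<beta>" by blast
  then have "card (supp d \<union> supp ?b) \<le> m" using card card_mono[OF finite] order.trans by blast
  then have 1: "\<bar>(X *v d) \<bullet> (X *v ?b)\<bar> / ?n \<le> (Lambda_max X m - Lambda_min X m) / 2 * norm d * norm ?b"
    using sub by (intro abs_inner_le_polarization) auto
  have "1 / ?n * ((X *v d) \<bullet> e) \<le> N * l1norm d"
    using inner_mat_le_l1norm[OF noise, of d] by linarith
  also have "\<dots> \<le> N * (sqrt (card I) * norm d)"
    using l1norm_vrestr_le_norm[of I "?o - \<beta>"] N by (simp add: d_def mult_left_mono)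
  finally have 2: "1 / ?n * ((X *v d) \<bullet> e) \<le> N * (sqrt (card I) * norm d)" .
  have "Lambda_min X (card I) * (norm d)\<^sup>2 \<le> (norm (X *v d))\<^sup>2 / ?n"
    using Lambda_min_le_norm_mult[of d "card I" X] sub(1) by (simp add: card_mono field_simps)
  also have "\<dots> = (X *v d) \<bullet> (X *v ?b) / ?n + 1 / ?n * ((X *v d) \<bullet> e)"
    by (simp add: eq add_divide_distrib)
  also have "(X *v d) \<bullet> (X *v ?b) / ?n \<le> \<bar>(X *v d) \<bullet> (X *v ?b)\<bar> / ?n"
    by (simp add: divide_right_mono)
  also note 1
  also note 2
  finally have *: "norm d * (Lambda_min X (card I) * norm d)
      \<le> norm d * ((Lambda_max X m - Lambda_min X m) / 2 * norm ?b + N * sqrt (card I))"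
    by (simp add: power2_eq_square algebra_simps)
  show ?thesis
  proof (cases "d = 0")
    case True
    then show ?thesis
      using N Lambda_min_le_Lambda_max[of X m] unfolding y_def[symmetric] d_def[symmetric] by simp
  next
    case False
    then show ?thesis using * unfolding y_def[symmetric] d_def[symmetric] by simp
  qed
qed

section \<open>Essential sparsity\<close>

lemma essential_sparsity_bounds:
  fixes \<beta> :: "real ^ 'p"
  shows "(\<Sum>i\<in>UNIV. min ((\<beta> $ i)\<^sup>2) (lam\<^sup>2 * \<sigma>\<^sup>2)) \<le> real (essential_sparsity lam \<sigma> \<beta>) * (lam\<^sup>2 * \<sigma>\<^sup>2)"
    and "essential_sparsity lam \<sigma> \<beta> \<le> card (supp \<beta>)"
proof -
  let ?P = "\<lambda>k. (\<Sum>i\<in>UNIV. min ((\<beta> $ i)\<^sup>2) (lam\<^sup>2 * \<sigma>\<^sup>2)) \<le> real k * lam\<^sup>2 * \<sigma>\<^sup>2"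
  have "(\<Sum>i\<in>UNIV. min ((\<beta> $ i)\<^sup>2) (lam\<^sup>2 * \<sigma>\<^sup>2)) = (\<Sum>i\<in>supp \<beta>. min ((\<beta> $ i)\<^sup>2) (lam\<^sup>2 * \<sigma>\<^sup>2))"
    by (rule sum.mono_neutral_right) (auto simp: supp_def)
  also have "\<dots> \<le> real (card (supp \<beta>)) * (lam\<^sup>2 * \<sigma>\<^sup>2)" by (rule sum_bounded_above) simp
  finally have P: "?P (card (supp \<beta>))" by (simp add: mult.assoc)
  show "(\<Sum>i\<in>UNIV. min ((\<beta> $ i)\<^sup>2) (lam\<^sup>2 * \<sigma>\<^sup>2)) \<le> real (essential_sparsity lam \<sigma> \<beta>) * (lam\<^sup>2 * \<sigma>\<^sup>2)"
    unfolding essential_sparsity_def using LeastI[of ?P, OF P] by (simp add: mult.assoc)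
  show "essential_sparsity lam \<sigma> \<beta> \<le> card (supp \<beta>)"
    unfolding essential_sparsity_def by (rule Least_le[of ?P, OF P])
qed

text \<open>Each entry above the level \<open>L\<close> uses up one full unit \<open>L\<^sup>2\<close> of the budget \<open>real k * L\<^sup>2\<close>; below the
  level the truncation is inactive, so what is left of the budget bounds the \<open>\<ell>\<^sub>2\<close> norm.\<close>

lemma norm_tail_le:
  assumes ess: "(\<Sum>i\<in>UNIV. min ((\<beta> $ i)\<^sup>2) (L\<^sup>2)) \<le> real k * L\<^sup>2" and L: "0 \<le> L"
    and U: "U \<inter> {j. \<bar>\<beta> $ j\<bar> > L} = {}"
  shows "(norm (vrestr U \<beta>))\<^sup>2 \<le> (real k - real (card {j. \<bar>\<beta> $ j\<bar> > L})) * L\<^sup>2"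
proof -
  let ?A = "{j. \<bar>\<beta> $ j\<bar> > L}" and ?f = "\<lambda>i. min ((\<beta> $ i)\<^sup>2) (L\<^sup>2)"
  have "(norm (vrestr U \<beta>))\<^sup>2 = sum ?f U"
    unfolding norm_vrestr_sq
  proof (rule sum.cong)
    fix i assume "i \<in> U"
    then have "\<bar>\<beta> $ i\<bar> \<le> \<bar>L\<bar>" using U L by force
    then show "(\<beta> $ i)\<^sup>2 = ?f i" by (simp add: abs_le_square_iff)
  qed simp
  also have "\<dots> = sum ?f (U \<union> ?A) - sum ?f ?A" using U by (simp add: sum.union_disjoint)
  also have "sum ?f ?A = (\<Sum>i\<in>?A. L\<^sup>2)"
  proof (rule sum.cong)
    fix i assume "i \<in> ?A"
    then have "\<bar>L\<bar> \<le> \<bar>\<beta> $ i\<bar>" using L by simp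
    then show "?f i = L\<^sup>2" by (simp add: abs_le_square_iff min_def)
  qed simp
  also have "sum ?f (U \<union> ?A) \<le> sum ?f UNIV" by (rule sum_mono2) auto
  finally show ?thesis using ess by (simp add: algebra_simps)
qed

section \<open>Estimation error of the Lasso and thresholding\<close>

text \<open>The regimes of the basic inequality are matched with the constants.  In the cone of opening \<open>3\<close>, and
  in the cone of opening \<open>4\<close> when \<open>W \<le> c4\<close>, restricted eigenvalues turn the bound for the prediction
  error into one for \<open>h\<close> on each of \<open>T0\<close> and \<open>T1\<close>, whence the factor \<open>sqrt 2\<close>.  In the remaining regime the small
  coefficients dominate, and the sparse eigenvalue bound yields \<open>const_D\<close>.\<close>

lemma lasso_error_bounds:
  fixes X :: "real ^ 'p ^ 'n"
  assumes p: "2 \<le> CARD('p)" and re: "RE X k 4" and pos: "0 < Lambda_min X (2 * k)"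
    and L: "0 < L" and d0: "0 < d0"
    and min: "is_arg_min (lasso_objective X (X *v \<beta> + e) (d0 * L)) (\<lambda>_. True) b"
    and noise: "infnorm ((1 / real CARD('n)) *\<^sub>R (transpose X *v e)) \<le> N" and N: "2 * N \<le> d0 * L"
    and h: "h = b - vrestr T0 \<beta>"
    and T0: "card T0 \<le> k" and T1: "largest_positions k h (- T0) T1"
    and tail: "(norm (vrestr (- T0) \<beta>))\<^sup>2 \<le> real k * L\<^sup>2" "card (supp (vrestr (- T0) \<beta>)) \<le> s - k"
  shows "l1norm (vrestr (- T0) h) \<le> const_D1 X d0 s k * L * real k"
    and "norm (vrestr (T0 \<union> T1) h) \<le> const_D0 X d0 s k * L * sqrt (real k)"
proof -
  let ?n = "real CARD('n)" and ?\<delta> = "vrestr (- T0) \<beta>" and ?\<Lambda> = "Lambda_max X (s - k)"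
  let ?K3 = "RE_const X k 3" and ?K4 = "RE_const X k 4"
  define A where "A = l1norm (vrestr T0 h)"
  define B where "B = l1norm (vrestr (- T0) h)"
  define x where "x = norm (X *v h) / sqrt ?n"
  define W where "W = sqrt ?\<Lambda> * L * sqrt k"
  define c3 where "c3 = d0 * L * sqrt k * ?K3"
  define c4 where "c4 = d0 * L * sqrt k * ?K4"
  have k: "1 \<le> k" using re by (simp add: RE_def)
  have re3: "RE X k 3" by (rule RE_antimono[OF re]) auto
  have K: "0 < ?K3" "0 < ?K4" using re re3 by (auto simp: RE_const_def RE_def)
  have \<Lambda>: "0 \<le> ?\<Lambda>" by (rule Lambda_max_nonneg)
  have nonneg: "0 \<le> x" "0 \<le> A" "0 \<le> B" "0 \<le> W" "0 \<le> c3"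
    using L d0 K \<Lambda> by (auto simp: x_def A_def B_def W_def c3_def l1norm_vrestr_nonneg)
  have "(norm (X *v ?\<delta>))\<^sup>2 \<le> ?n * ?\<Lambda> * (norm ?\<delta>)\<^sup>2"
    by (rule norm_mult_le_Lambda_max[OF tail(2)])
  also have "\<dots> \<le> ?n * ?\<Lambda> * (real k * L\<^sup>2)" using tail(1) \<Lambda> by (intro mult_left_mono) auto
  finally have "(norm (X *v ?\<delta>) / sqrt ?n)\<^sup>2 \<le> W\<^sup>2"
    using \<Lambda> by (simp add: W_def power_mult_distrib power_divide field_simps)
  then have w: "norm (X *v ?\<delta>) / sqrt ?n \<le> W" using nonneg(4) by (rule power2_le_imp_le)
  have "2 * x\<^sup>2 + d0 * L * B \<le> 2 * x * (norm (X *v ?\<delta>) / sqrt ?n) + 3 * (d0 * L * A)"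
    unfolding x_def A_def B_def using lasso_basic_inequality[OF min noise N _ h] d0 L by simp
  also have "\<dots> \<le> 2 * x * W + 3 * (d0 * L * A)"
    using mult_left_mono[OF w, of "2 * x"] nonneg(1) by simp
  finally have basic: "2 * x\<^sup>2 + d0 * L * B \<le> 2 * x * W + 3 * (d0 * L * A)" .
  have cancel: "d0 * L * B \<le> c * (d0 * L * A) \<longleftrightarrow> B \<le> c * A" for c
    using d0 L by (simp add: mult.left_commute[of c])
  have A_le: "d0 * L * A \<le> d0 * L * sqrt k * RE_const X k c * x" if "RE X k c" "B \<le> c * A" for c
  proof -
    have "A \<le> sqrt (card T0) * norm (vrestr T0 h)" unfolding A_def by (rule l1norm_vrestr_le_norm)
    also have "\<dots> \<le> sqrt k * (RE_const X k c * x)"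
      using RE_cone_bound[OF that(1) T0] that(2) T0 unfolding A_def B_def x_def
      by (intro mult_mono) auto
    finally show ?thesis using d0 L by (simp add: mult.assoc mult_left_mono)
  qed
  have N_le: "norm (vrestr (T0 \<union> T1) h) \<le> sqrt 2 * (RE_const X k c * x)"
    if c: "RE X k c" "B \<le> c * A" for c
  proof (rule power2_le_imp_le)
    have T1': "T0 \<inter> T1 = {}" "card T1 \<le> k" using T1 by (auto simp: largest_positions_def)
    have Kx: "0 \<le> RE_const X k c * x" using c(1) nonneg(1) by (simp add: RE_const_def RE_def)
    have "norm (vrestr T h) \<le> RE_const X k c * x" if "card T \<le> k" for T
      using RE_cone_bound_any_set[OF c(1) T0 _ that] c(2) unfolding A_def B_def x_def by simp
    then have "(norm (vrestr T0 h))\<^sup>2 \<le> (RE_const X k c * x)\<^sup>2" "(norm (vrestr T1 h))\<^sup>2 \<le> (RE_const X k c * x)\<^sup>2"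
      using T0 T1'(2) by (simp_all add: power_mono)
    moreover have "(norm (vrestr (T0 \<union> T1) h))\<^sup>2 = (norm (vrestr T0 h))\<^sup>2 + (norm (vrestr T1 h))\<^sup>2"
      unfolding norm_vrestr_sq using T1'(1) by (simp add: sum.union_disjoint)
    ultimately show "(norm (vrestr (T0 \<union> T1) h))\<^sup>2 \<le> (sqrt 2 * (RE_const X k c * x))\<^sup>2"
      by (simp add: power_mult_distrib)
    show "0 \<le> sqrt 2 * (RE_const X k c * x)" using Kx by simp
  qed
  have regimes: "B \<le> 3 * A \<and> x \<le> W + 3 / 2 * c3 \<and> d0 * L * B \<le> W\<^sup>2 + 9 / 4 * c3\<^sup>2 \<or>
    x \<le> W \<and> (d0 * L * B \<le> 3 * W\<^sup>2 \<or> B \<le> 4 * A \<and> W \<le> c4 \<and> d0 * L * B \<le> 4 * c4\<^sup>2)"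
    using lasso_regimes[OF basic, of c3 c4] A_le[OF re3] A_le[OF re] nonneg d0 L
    unfolding cancel c3_def[symmetric] c4_def[symmetric] by simp
  define q where "q = d0\<^sup>2 * L\<^sup>2 * real k"
  define m where "m = max (max (?\<Lambda> / d0\<^sup>2 + 9 / 4 * ?K3\<^sup>2) (4 * ?K4\<^sup>2)) (3 * ?\<Lambda> / d0\<^sup>2)"
  have sq: "W\<^sup>2 = q * (?\<Lambda> / d0\<^sup>2)" "c3\<^sup>2 = q * ?K3\<^sup>2" "c4\<^sup>2 = q * ?K4\<^sup>2"
    using \<Lambda> d0 by (simp_all add: q_def W_def c3_def c4_def power_mult_distrib)
  have "W\<^sup>2 + 9 / 4 * c3\<^sup>2 = q * (?\<Lambda> / d0\<^sup>2 + 9 / 4 * ?K3\<^sup>2)" "3 * W\<^sup>2 = q * (3 * ?\<Lambda> / d0\<^sup>2)"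
    "4 * c4\<^sup>2 = q * (4 * ?K4\<^sup>2)"
    unfolding sq by (simp_all add: distrib_left)
  moreover have "q * t \<le> q * m" if "t \<le> m" for t using that by (simp add: q_def mult_left_mono)
  ultimately have "W\<^sup>2 + 9 / 4 * c3\<^sup>2 \<le> q * m" "3 * W\<^sup>2 \<le> q * m" "4 * c4\<^sup>2 \<le> q * m"
    by (simp_all only: m_def le_max_iff_disj order_refl simp_thms)
  then have "d0 * L * B \<le> q * m" using regimes by linarith
  also have "\<dots> = d0 * L * (const_D1 X d0 s k * L * real k)"
    by (simp add: const_D1_def m_def q_def power2_eq_square mult_ac)
  finally show "l1norm (vrestr (- T0) h) \<le> const_D1 X d0 s k * L * real k"
    unfolding B_def[symmetric] using d0 L by simp
  let ?N = "norm (vrestr (T0 \<union> T1) h)"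
  let ?E = "sqrt 2 * (d0 * ?K4\<^sup>2 + ?K3 * sqrt ?\<Lambda> + 2 * d0 * ?K3\<^sup>2)"
  consider (cone3) "B \<le> 3 * A" "x \<le> W + 3 / 2 * c3" | (tail) "x \<le> W" "d0 * L * B \<le> 3 * W\<^sup>2"
    | (cone4) "x \<le> W" "B \<le> 4 * A" "W \<le> c4"
    using regimes by blast
  then show "?N \<le> const_D0 X d0 s k * L * sqrt (real k)"
  proof cases
    case cone3
    have "?N \<le> sqrt 2 * (?K3 * (W + 3 / 2 * c3))"
      using N_le[OF re3 cone3(1)] cone3(2) K(1) by (meson mult_left_mono order.trans less_imp_le real_sqrt_ge_zero zero_le_numeral)
    also have "\<dots> = (sqrt 2 * (?K3 * sqrt ?\<Lambda> + 3 / 2 * d0 * ?K3\<^sup>2)) * (L * sqrt k)"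
      by (simp add: W_def c3_def power2_eq_square algebra_simps)
    also have "\<dots> \<le> ?E * (L * sqrt k)"
      using d0 L by (intro mult_right_mono mult_left_mono) (auto simp: add_mono add_increasing mult_right_mono)
    also have "\<dots> \<le> const_D0 X d0 s k * (L * sqrt k)"
      using L by (intro mult_right_mono) (auto simp: const_D0_def)
    finally show ?thesis by (simp add: mult.assoc)
  next
    case cone4
    have "?N \<le> sqrt 2 * (?K4 * c4)"
      using N_le[OF re cone4(2)] cone4(1,3) K(2) by (meson mult_left_mono order.trans less_imp_le real_sqrt_ge_zero zero_le_numeral)
    also have "\<dots> = (sqrt 2 * (d0 * ?K4\<^sup>2)) * (L * sqrt k)"
      by (simp add: c4_def power2_eq_square algebra_simps)
    also have "\<dots> \<le> ?E * (L * sqrt k)"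
      using d0 L K \<Lambda> by (intro mult_right_mono mult_left_mono) auto
    also have "\<dots> \<le> const_D0 X d0 s k * (L * sqrt k)"
      using L by (intro mult_right_mono) (auto simp: const_D0_def)
    finally show ?thesis by (simp add: mult.assoc)
  next
    case tail
    let ?m = "sqrt (Lambda_min X (2 * k))"
    have ell: "0 \<le> ell X k"
      using theta_nonneg[of k "2 * k" X] p k pos Lambda_max_nonneg[of X k] by (simp add: ell_def)
    have "d0 * L * B \<le> d0 * L * (3 * ?\<Lambda> / d0 * L * k)"
    proof -
      have "W\<^sup>2 = ?\<Lambda> * (L * L) * k"
        using \<Lambda> by (simp add: W_def power_mult_distrib power2_eq_square[of L])
      then show ?thesis using tail(2) d0 by (simp add: mult_ac)
    qed
    then have "B \<le> 3 * ?\<Lambda> / d0 * L * k" using d0 L by (simp only: mult_le_cancel_left_pos mult_pos_pos)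
    then have "B / sqrt k \<le> 3 * ?\<Lambda> / d0 * L * k / sqrt k" by (rule divide_right_mono) simp
    also have "\<dots> = 3 * ?\<Lambda> / d0 * L * sqrt k" by (simp add: real_div_sqrt flip: times_divide_eq_right)
    finally have B: "B / sqrt k \<le> 3 * ?\<Lambda> / d0 * L * sqrt k" .
    have "?m * ?N \<le> x + ell X k * (B / sqrt k)"
      unfolding x_def B_def by (rule norm_two_blocks_le[OF k p pos T0 T1])
    also have "\<dots> \<le> W + ell X k * (3 * ?\<Lambda> / d0 * L * sqrt k)"
      using tail(1) mult_left_mono[OF B ell] by (rule add_mono)
    also have "\<dots> = ?m * (const_D X d0 s k * (L * sqrt k))"
    proof -
      have "?m * const_D X d0 s k = sqrt ?\<Lambda> * (1 + 3 * ell X k * sqrt ?\<Lambda> / d0)"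
        using pos by (simp add: const_D_def real_sqrt_divide)
      also have "\<dots> = sqrt ?\<Lambda> + ell X k * (3 * ?\<Lambda> / d0)"
        using \<Lambda> by (simp add: distrib_left mult_ac flip: power2_eq_square)
      finally have "?m * const_D X d0 s k = sqrt ?\<Lambda> + ell X k * (3 * ?\<Lambda> / d0)" .
      then have "(?m * const_D X d0 s k) * (L * sqrt k) = (sqrt ?\<Lambda> + ell X k * (3 * ?\<Lambda> / d0)) * (L * sqrt k)"
        by simp
      then show ?thesis by (simp add: W_def algebra_simps)
    qed
    finally have "?N \<le> const_D X d0 s k * (L * sqrt k)" using pos by simp
    also have "\<dots> \<le> const_D0 X d0 s k * (L * sqrt k)"
      using L by (intro mult_right_mono) (auto simp: const_D0_def)
    finally show ?thesis by (simp add: mult.assoc)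
  qed
qed

text \<open>The \<open>\<ell>\<^sub>2\<close> bound controls each coordinate of \<open>h\<close>, so the large coefficients survive the threshold.  An
  entry outside \<open>T0 \<union> T1\<close> is dominated by all \<open>k\<close> entries on \<open>T1\<close>; averaging over \<open>T1\<close> turns the
  \<open>\<ell>\<^sub>1\<close> bound into \<open>D1 * L\<close> and the \<open>\<ell>\<^sub>2\<close> bound into \<open>D0 * L\<close>, both below their perturbed versions.\<close>

lemma thresholding_selects:
  assumes k: "1 \<le> k" and pos: "0 < L" and t0: "D1 < D1b" "D0 < D0b" "t0 = min D1b D0b * L"
    and T1: "largest_positions k b (- T0) T1"
    and h: "h = b - vrestr T0 \<beta>"
    and l1: "l1norm (vrestr (- T0) h) \<le> D1 * L * real k"
    and l2: "norm (vrestr (T0 \<union> T1) h) \<le> D0 * L * sqrt (real k)"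
    and A: "A \<subseteq> T0" "\<And>j. j \<in> A \<Longrightarrow> D0 * L * sqrt (real k) + t0 \<le> \<bar>\<beta> $ j\<bar>"
  shows "A \<subseteq> {j. t0 \<le> \<bar>b $ j\<bar>}" "{j. t0 \<le> \<bar>b $ j\<bar>} \<subseteq> T0 \<union> T1"
proof -
  show "A \<subseteq> {j. t0 \<le> \<bar>b $ j\<bar>}"
  proof
    fix j assume j: "j \<in> A"
    have "\<bar>vrestr (T0 \<union> T1) h $ j\<bar> \<le> D0 * L * sqrt (real k)"
      using component_le_norm_cart l2 by (rule order.trans)
    then have "\<bar>b $ j - \<beta> $ j\<bar> \<le> D0 * L * sqrt (real k)" using j A(1) h by auto
    then show "j \<in> {j. t0 \<le> \<bar>b $ j\<bar>}" using A(2)[OF j] by simp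
  qed
  show "{j. t0 \<le> \<bar>b $ j\<bar>} \<subseteq> T0 \<union> T1"
  proof (rule ccontr)
    assume "\<not> {j. t0 \<le> \<bar>b $ j\<bar>} \<subseteq> T0 \<union> T1"
    then obtain j where j: "t0 \<le> \<bar>b $ j\<bar>" "j \<notin> T0" "j \<notin> T1" by auto
    have T1': "T1 \<subseteq> - T0" "\<And>i. i \<in> T1 \<Longrightarrow> \<bar>b $ j\<bar> \<le> \<bar>b $ i\<bar>"
      using T1 j by (auto simp: largest_positions_def)
    have card: "card T1 = k" using card_largest_positions[OF T1, of j] j by simp
    have le: "\<bar>b $ j\<bar> \<le> \<bar>h $ i\<bar>" if "i \<in> T1" for i using T1' that h by auto
    have "k * \<bar>b $ j\<bar> \<le> (\<Sum>i\<in>T1. \<bar>h $ i\<bar>)"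
      unfolding card[symmetric] by (rule sum_bounded_below) (rule le)
    also have "\<dots> \<le> l1norm (vrestr (- T0) h)"
      unfolding l1norm_vrestr using T1'(1) by (intro sum_mono2) auto
    finally have "real k * \<bar>b $ j\<bar> \<le> real k * (D1 * L)" using l1 by (simp add: mult_ac)
    then have "\<bar>b $ j\<bar> \<le> D1 * L" using k by simp
    moreover have "\<bar>b $ j\<bar> \<le> D0 * L"
    proof -
      have "k * \<bar>b $ j\<bar>\<^sup>2 \<le> (\<Sum>i\<in>T1. (h $ i)\<^sup>2)"
        unfolding card[symmetric]
      proof (rule sum_bounded_below)
        fix i assume "i \<in> T1"
        then show "\<bar>b $ j\<bar>\<^sup>2 \<le> (h $ i)\<^sup>2" using le[of i] by (simp add: abs_le_square_iff)
      qed
      also have "\<dots> \<le> (norm (vrestr (T0 \<union> T1) h))\<^sup>2"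
        unfolding norm_vrestr_sq by (intro sum_mono2) auto
      also have "\<dots> \<le> (D0 * L * sqrt (real k))\<^sup>2" using l2 by (intro power_mono) auto
      finally have "real k * \<bar>b $ j\<bar>\<^sup>2 \<le> real k * (D0 * L)\<^sup>2" by (simp add: power_mult_distrib mult_ac)
      then have "\<bar>b $ j\<bar>\<^sup>2 \<le> (D0 * L)\<^sup>2" using k by simp
      moreover have "0 \<le> D0 * L * sqrt (real k)" using norm_ge_zero l2 by (rule order.trans)
      then have "0 \<le> D0 * L" using k by (simp add: zero_le_mult_iff)
      ultimately show ?thesis by (rule power2_le_imp_le)
    qed
    moreover have "D1 * L < D1b * L" "D0 * L < D0b * L" using pos t0 by simp_all
    ultimately have "\<bar>b $ j\<bar> < t0" using t0(3) by (simp add: min_def)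
    then show False using j(1) by simp
  qed
qed

lemma largest_positions_contain_exceedances:
  assumes "largest_positions k v UNIV T" "card {j. c < \<bar>v $ j\<bar>} \<le> k"
  shows "{j. c < \<bar>v $ j\<bar>} \<subseteq> T"
proof (rule ccontr)
  assume "\<not> {j. c < \<bar>v $ j\<bar>} \<subseteq> T"
  then obtain j where j: "c < \<bar>v $ j\<bar>" "j \<notin> T" by auto
  have T: "card T = min k CARD('a)" "\<And>i. i \<in> T \<Longrightarrow> \<bar>v $ j\<bar> \<le> \<bar>v $ i\<bar>"
    using assms(1) j by (auto simp: largest_positions_def)
  have "insert j T \<subseteq> {j. c < \<bar>v $ j\<bar>}" using j(1) T(2) by force
  then have le: "card (insert j T) \<le> card {j. c < \<bar>v $ j\<bar>}" by (rule card_mono[OF finite])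
  have "card (insert j T) \<le> CARD('a)" by (rule card_mono) auto
  then show False using le assms(2) T(1) j(2) by simp
qed

text \<open>The second summand of the factor comes from squaring the error bound on \<open>I\<close> with
  \<open>(u + v)\<^sup>2 \<le> 2 * u\<^sup>2 + 2 * v\<^sup>2\<close>; the first is the truncation error off \<open>I\<close>.  If \<open>I\<close> is empty,
  the error on \<open>I\<close> vanishes, in agreement with the value \<open>0\<close> of the quotient.\<close>

lemma ols_total_error:
  fixes X :: "real ^ 'p ^ 'n"
  assumes pos: "0 < Lambda_min X (card I) \<or> I = {}"
    and card: "card (I \<union> supp \<beta>) \<le> m" "card I \<le> 2 * k"
    and noise: "infnorm ((1 / real CARD('n)) *\<^sub>R (transpose X *v e)) \<le> sqrt (1 + a) * L"
    and a: "0 \<le> a"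
    and tail: "(norm (vrestr (- I) \<beta>))\<^sup>2 \<le> real k * L\<^sup>2"
  shows "(norm (ols X (X *v \<beta> + e) I - \<beta>))\<^sup>2
    \<le> (1 + ((Lambda_max X m - Lambda_min X m)\<^sup>2 + 8 * (1 + a)) / (2 * (Lambda_min X (card I))\<^sup>2))
        * real k * L\<^sup>2"
proof -
  let ?o = "ols X (X *v \<beta> + e) I" and ?l = "Lambda_min X (card I)"
  let ?\<theta> = "(Lambda_max X m - Lambda_min X m) / 2" and ?b = "norm (vrestr (- I) \<beta>)"
  define r where "r = norm (vrestr I (?o - \<beta>))"
  have "(norm (?o - \<beta>))\<^sup>2 = (norm (vrestr I (?o - \<beta>)))\<^sup>2 + (norm (vrestr (- I) (?o - \<beta>)))\<^sup>2"
    unfolding norm_vrestr_sq norm_sq_sum[of "?o - \<beta>"]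
    using sum.union_disjoint[of I "- I" "\<lambda>j. ((?o - \<beta>) $ j)\<^sup>2"] by (simp add: Compl_partition)
  also have "vrestr (- I) (?o - \<beta>) = - vrestr (- I) \<beta>" by (auto simp: vec_eq_iff ols_def)
  finally have split: "(norm (?o - \<beta>))\<^sup>2 = r\<^sup>2 + ?b\<^sup>2" by (simp add: r_def)
  have "r\<^sup>2 \<le> ((Lambda_max X m - Lambda_min X m)\<^sup>2 + 8 * (1 + a)) / (2 * ?l\<^sup>2) * (real k * L\<^sup>2)"
  proof (cases "I = {}")
    case True
    then show ?thesis by (simp add: r_def norm_vrestr_sq Lambda_min_def)
  next
    case False
    then have l: "0 < ?l" using pos by simp
    let ?u = "?\<theta> * ?b" and ?v = "sqrt (1 + a) * L * sqrt (card I)"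
    have "?l * r \<le> ?u + ?v"
      unfolding r_def by (rule ols_error_on_model[OF l card(1) noise])
    then have "(?l * r)\<^sup>2 \<le> (?u + ?v)\<^sup>2" using l by (intro power_mono) (auto simp: r_def)
    also have "\<dots> \<le> 2 * ?u\<^sup>2 + 2 * ?v\<^sup>2"
      using zero_le_power2[of "?u - ?v"] by (simp add: power2_sum power2_diff)
    also have "\<dots> = 2 * (?\<theta>\<^sup>2 * ?b\<^sup>2) + 2 * ((1 + a) * L\<^sup>2 * card I)"
      unfolding power_mult_distrib using a by simp
    also have "\<dots> \<le> 2 * (?\<theta>\<^sup>2 * (real k * L\<^sup>2)) + 2 * ((1 + a) * L\<^sup>2 * real (2 * k))"
    proof (intro add_mono mult_left_mono)
      show "real (card I) \<le> real (2 * k)" using card(2) by (rule of_nat_mono)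
    qed (use tail a in auto)
    also have "\<dots> = ((Lambda_max X m - Lambda_min X m)\<^sup>2 + 8 * (1 + a)) / 2 * (real k * L\<^sup>2)"
      by (simp add: power_divide field_simps)
    finally show ?thesis using l by (simp add: power_mult_distrib field_simps)
  qed
  then show ?thesis using split tail by (simp add: algebra_simps)
qed

section \<open>The thresholded Lasso\<close>

theorem theorem4p4:
  fixes X :: "real ^ 'p ^ 'n" and \<beta> :: "real ^ 'p"
    and M :: "'w measure" and \<epsilon> Y :: "'w \<Rightarrow> real ^ 'n" and \<beta>init :: "'w \<Rightarrow> real ^ 'p"
    and \<sigma> lam a d0 D1b D0b t0 :: real and s s0 a0 :: nat
    and A0 T0 :: "'p set" and T1 :: "'w \<Rightarrow> 'p set"
  assumes dims: "CARD('n) \<le> CARD('p)" "2 \<le> CARD('p)"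
    and sigma: "0 < \<sigma>"
    and noise: "prob_space M"
      "prob_space.indep_vars M (\<lambda>_. borel) (\<lambda>i \<omega>. \<epsilon> \<omega> $ i) UNIV"
      "\<And>i. distributed M lborel (\<lambda>\<omega>. \<epsilon> \<omega> $ i) (normal_density 0 \<sigma>)"
    and model: "\<And>\<omega>. \<omega> \<in> space M \<Longrightarrow> Y \<omega> = X *v \<beta> + \<epsilon> \<omega>"
    and columns: "\<And>j. norm (column j X) = sqrt (real CARD('n))"
    and lam: "lam = base_level CARD('n) CARD('p)"
    and s: "s = card (supp \<beta>)"
    and s0: "s0 = essential_sparsity lam \<sigma> \<beta>"
    and Lmax_finite: "bdd_above (sparse_quotients X (2 * s))"
    and Lmin_pos: "0 < Lambda_min X (2 * s)"
    and re: "RE X s0 4"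
    and a: "0 \<le> a"
    and d0: "2 * sqrt (1 + a) \<le> d0"
    and lasso: "\<And>\<omega>. \<omega> \<in> space M \<Longrightarrow>
      is_arg_min (lasso_objective X (Y \<omega>) (d0 * lam * \<sigma>)) (\<lambda>_. True) (\<beta>init \<omega>)"
    and T0: "largest_positions s0 \<beta> UNIV T0"
    and T1: "\<And>\<omega>. \<omega> \<in> space M \<Longrightarrow> largest_positions s0 (\<beta>init \<omega>) (- T0) (T1 \<omega>)"
    and A0: "A0 = {j. \<bar>\<beta> $ j\<bar> > lam * \<sigma>}"
    and a0: "a0 = card A0"
    and D1b: "const_D1 X d0 s s0 < D1b"
    and D0b: "const_D0 X d0 s s0 < D0b"
    and beta_min: "A0 \<noteq> {} \<Longrightarrow> Min ((\<lambda>j. \<bar>\<beta> $ j\<bar>) ` A0)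
      \<ge> const_D0 X d0 s s0 * lam * \<sigma> * sqrt (real s0) + min D1b D0b * lam * \<sigma>"
    and t0: "t0 = min D1b D0b * lam * \<sigma>"
  shows "\<forall>\<omega>\<in>space M. \<epsilon> \<omega> \<in> noise_event X \<sigma> a \<longrightarrow>
    (let T01 = T0 \<union> T1 \<omega>; I = {j. t0 \<le> \<bar>\<beta>init \<omega> $ j\<bar>}; D = UNIV - I in
       card I \<le> 2 * s0 \<and>
       A0 \<subseteq> I \<and>
       I \<inter> - T01 = {} \<and>
       norm (vrestr D \<beta>) \<le> lam * \<sigma> * sqrt (real s0 - real a0) \<and>
       (norm (ols X (Y \<omega>) I - \<beta>))\<^sup>2
         \<le> (1 + ((Lambda_max X (2 * s) - Lambda_min X (2 * s))\<^sup>2 + 8 * (1 + a))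
                / (2 * (Lambda_min X (card I))\<^sup>2)) * real s0 * lam\<^sup>2 * \<sigma>\<^sup>2)"
proof (intro ballI impI)
  fix \<omega> assume \<omega>: "\<omega> \<in> space M" and event: "\<epsilon> \<omega> \<in> noise_event X \<sigma> a"
  define L where "L = lam * \<sigma>"
  define I where "I = {j. t0 \<le> \<bar>\<beta>init \<omega> $ j\<bar>}"
  define h where "h = \<beta>init \<omega> - vrestr T0 \<beta>"
  have "0 < lam" using dims(2) by (simp add: lam base_level_def)
  then have L: "0 < L" using sigma by (simp add: L_def)
  have L2: "lam\<^sup>2 * \<sigma>\<^sup>2 = L\<^sup>2" by (simp add: L_def power_mult_distrib)
  have "0 < 2 * sqrt (1 + a)" using a by simp
  then have d0_pos: "0 < d0" using d0 by linarith
  have s0_pos: "1 \<le> s0" using re by (simp add: RE_def)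
  have ess: "(\<Sum>i\<in>UNIV. min ((\<beta> $ i)\<^sup>2) (L\<^sup>2)) \<le> real s0 * L\<^sup>2" and s0_le: "s0 \<le> s"
    using essential_sparsity_bounds[where lam = lam and \<sigma> = \<sigma> and \<beta> = \<beta>] by (simp_all only: L2 s0 s)
  have Lmin: "0 < Lambda_min X m" if "1 \<le> m" "m \<le> 2 * s" for m
    using Lambda_min_antimono[OF that, of X] Lmin_pos by linarith
  have A0': "A0 = {j. L < \<bar>\<beta> $ j\<bar>}" by (simp add: A0 L_def)
  have tail: "(norm (vrestr U \<beta>))\<^sup>2 \<le> (real s0 - real a0) * L\<^sup>2" if "U \<inter> A0 = {}" for U
    using norm_tail_le[OF ess _ that[unfolded A0']] L by (simp add: a0 A0')
  have "0 \<le> (real s0 - real a0) * L\<^sup>2"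
    using tail[of "{}"] by (meson Int_empty_left order.trans zero_le_power2)
  then have a0_le: "a0 \<le> s0" using L by (simp add: zero_le_mult_iff)
  have "s \<le> CARD('p)" unfolding s by (rule card_mono) auto
  then have card_T0: "card T0 = s0" using T0 s0_le by (simp add: largest_positions_def)
  \<comment> \<open>The budget left after paying for \<open>A0\<close> is nonnegative, so \<open>A0\<close> fits into the \<open>s0\<close> leading positions.\<close>
  have A0_T0: "A0 \<subseteq> T0"
    using largest_positions_contain_exceedances[OF T0, of L] a0_le by (simp add: a0 A0')
  have T0_supp: "T0 \<subseteq> supp \<beta>"
  proof
    fix i assume i: "i \<in> T0"
    show "i \<in> supp \<beta>"
    proof (rule ccontr)
      assume "i \<notin> supp \<beta>"
      then have "\<beta> $ i = 0" by (simp add: supp_def)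
      then have "supp \<beta> \<subseteq> T0 - {i}"
        using T0 i by (fastforce simp: largest_positions_def supp_def)
      then have "s \<le> card (T0 - {i})" unfolding s by (rule card_mono[OF finite])
      then show False using card_T0 s0_le s0_pos i by simp
    qed
  qed
  have T1h: "largest_positions s0 h (- T0) (T1 \<omega>)"
    using T1[OF \<omega>] by (auto simp: largest_positions_def h_def)
  define N where "N = sqrt (1 + a) * L"
  have noise_le: "infnorm ((1 / real CARD('n)) *\<^sub>R (transpose X *v \<epsilon> \<omega>)) \<le> N"
    using event by (simp add: noise_event_def N_def L_def lam base_level_def mult_ac)
  have N: "2 * N \<le> d0 * L" using d0 L by (simp add: N_def mult_right_mono)
  have min: "is_arg_min (lasso_objective X (X *v \<beta> + \<epsilon> \<omega>) (d0 * L)) (\<lambda>_. True) (\<beta>init \<omega>)"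
    using lasso[OF \<omega>] model[OF \<omega>] by (simp add: L_def mult.assoc)
  have tail_T0: "(norm (vrestr (- T0) \<beta>))\<^sup>2 \<le> real s0 * L\<^sup>2"
  proof -
    have "(norm (vrestr (- T0) \<beta>))\<^sup>2 \<le> (real s0 - real a0) * L\<^sup>2" using A0_T0 by (intro tail) auto
    also have "\<dots> \<le> real s0 * L\<^sup>2" by (intro mult_right_mono) auto
    finally show ?thesis .
  qed
  have supp_tail: "card (supp (vrestr (- T0) \<beta>)) \<le> s - s0"
  proof -
    have "supp (vrestr (- T0) \<beta>) = supp \<beta> - T0" by (auto simp: supp_def)
    then show ?thesis using T0_supp by (simp add: card_Diff_subset s card_T0)
  qed
  have pos2: "0 < Lambda_min X (2 * s0)" using s0_le s0_pos by (intro Lmin) auto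
  note bounds = lasso_error_bounds[OF dims(2) re pos2 L d0_pos min noise_le N h_def _ T1h tail_T0 supp_tail]
  have "\<bar>\<beta> $ j\<bar> \<ge> const_D0 X d0 s s0 * L * sqrt (real s0) + t0" if "j \<in> A0" for j
  proof -
    have "Min ((\<lambda>j. \<bar>\<beta> $ j\<bar>) ` A0) \<le> \<bar>\<beta> $ j\<bar>" using that by (intro Min_le) auto
    then show ?thesis using beta_min that by (force simp: t0 L_def mult.assoc)
  qed
  note select = thresholding_selects[OF s0_pos L D1b D0b _ T1[OF \<omega>] h_def bounds A0_T0 this,
      folded I_def]
  have I: "A0 \<subseteq> I" "I \<subseteq> T0 \<union> T1 \<omega>"
    using select by (simp_all add: t0 L_def card_T0 mult.assoc)
  have "card (T1 \<omega>) \<le> s0" using T1h by (simp add: largest_positions_def)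
  then have card_T01: "card (T0 \<union> T1 \<omega>) \<le> 2 * s0"
    using card_Un_le[of T0 "T1 \<omega>"] card_T0 by simp
  then have card_I: "card I \<le> 2 * s0" using card_mono[OF finite I(2)] by linarith
  have "(norm (vrestr (- I) \<beta>))\<^sup>2 \<le> (real s0 - real a0) * L\<^sup>2" using I(1) by (intro tail) auto
  note tail_I = this
  have "norm (vrestr (UNIV - I) \<beta>) \<le> lam * \<sigma> * sqrt (real s0 - real a0)"
  proof (rule power2_le_imp_le)
    show "(norm (vrestr (UNIV - I) \<beta>))\<^sup>2 \<le> (lam * \<sigma> * sqrt (real s0 - real a0))\<^sup>2"
      using tail_I a0_le by (simp add: Compl_eq_Diff_UNIV L_def power_mult_distrib mult_ac)
  qed (use L a0_le in \<open>simp add: L_def\<close>)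
  moreover have "(norm (ols X (Y \<omega>) I - \<beta>))\<^sup>2
         \<le> (1 + ((Lambda_max X (2 * s) - Lambda_min X (2 * s))\<^sup>2 + 8 * (1 + a))
                / (2 * (Lambda_min X (card I))\<^sup>2)) * real s0 * L\<^sup>2"
    unfolding model[OF \<omega>]
  proof (rule ols_total_error)
    show "0 < Lambda_min X (card I) \<or> I = {}"
    proof (cases "I = {}")
      case False
      then have "1 \<le> card I" by (simp add: Suc_le_eq card_gt_0_iff)
      then show ?thesis using card_I s0_le by (intro disjI1 Lmin) auto
    qed simp
    \<comment> \<open>The set \<open>T0\<close> lies inside the support, so only \<open>T1\<close> enlarges it.\<close>
    have "I \<union> supp \<beta> \<subseteq> T1 \<omega> \<union> supp \<beta>" using I(2) T0_supp by blast
    then have "card (I \<union> supp \<beta>) \<le> card (T1 \<omega> \<union> supp \<beta>)" by (rule card_mono[OF finite])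
    also have "\<dots> \<le> card (T1 \<omega>) + card (supp \<beta>)" by (rule card_Un_le)
    finally show "card (I \<union> supp \<beta>) \<le> 2 * s" using \<open>card (T1 \<omega>) \<le> s0\<close> s0_le s by simp
    have "(real s0 - real a0) * L\<^sup>2 \<le> real s0 * L\<^sup>2" by (intro mult_right_mono) auto
    then show "(norm (vrestr (- I) \<beta>))\<^sup>2 \<le> real s0 * L\<^sup>2" using tail_I by (rule order.trans[rotated])
  qed (use card_I a noise_le in \<open>auto simp: N_def\<close>)
  ultimately show "let T01 = T0 \<union> T1 \<omega>; I = {j. t0 \<le> \<bar>\<beta>init \<omega> $ j\<bar>}; D = UNIV - I in
       card I \<le> 2 * s0 \<and>
       A0 \<subseteq> I \<and>
       I \<inter> - T01 = {} \<and>
       norm (vrestr D \<beta>) \<le> lam * \<sigma> * sqrt (real s0 - real a0) \<and>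
       (norm (ols X (Y \<omega>) I - \<beta>))\<^sup>2
         \<le> (1 + ((Lambda_max X (2 * s) - Lambda_min X (2 * s))\<^sup>2 + 8 * (1 + a))
                / (2 * (Lambda_min X (card I))\<^sup>2)) * real s0 * lam\<^sup>2 * \<sigma>\<^sup>2"
    using card_I I unfolding Let_def I_def[symmetric] by (auto simp: L_def power_mult_distrib mult.assoc)
qed

end
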